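(* Let $c>0$, let $\Gamma_1=\Gamma_2$ be a nonzero integer, and let $r_1,r_2\in[0,1)$ with $r_1+r_2>0$. Consider the fixed points (relative equilibria for a pair of vortices of the same sign) $$\mu_0=(\mu_1,\mu_2,\mu_3,\mu_4)=(r_1^2,\,r_2^2,\,-r_1r_2,\,0)$$ of the two-vortex relative dynamics, where either A: $r_1=r_2$, or B: $c(1-r_1^2)(1-r_2^2)=r_1r_2(r_1+r_2)^2$. (i) Relative equilibrium A is Lyapunov stable if $c(1-r_1^2)^2>4r_1^4$ and unstable if $c(1-r_1^2)^2<4r_1^4$. (ii) With $$F_1(r_1,r_2)=(r_1^2+r_2^2)^2+(r_1^2+r_2^2)(r_1^2r_2^2+4r_1r_2-3)+2(r_1-r_2)^2,$$ relative equilibrium B is Lyapunov stable if $F_1(r_1,r_2)<0$ and unstable if $F_1(r_1,r_2)>0$.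
   Context: Two vortices at $z_1,z_2$ in the open unit disc of $\mathbb C$ with equal charges $\Gamma_1=\Gamma_2$ are described, modulo rotation about the origin, by $\mathrm i zz^*$, with coordinates $\mu_1=|z_1|^2$, $\mu_2=|z_2|^2$, $\mu_3+\mathrm i\mu_4=z_1\overline{z_2}$. The relative dynamics (Lie–Poisson equation) in $(\mu_1,\mu_2,\mu_3,\mu_4)\in\mathbb R^4$, on the open set where $\mu_1,\mu_2<1$ and $\mu_1+\mu_2-2\mu_3>0$, is $$\dot\mu_1=2c\Gamma_1\frac{\mu_4}{\mu_1+\mu_2-2\mu_3},\qquad \dot\mu_2=-2c\Gamma_1\frac{\mu_4}{\mu_1+\mu_2-2\mu_3},\qquad \dot\mu_3=\Gamma_1\frac{(\mu_1-\mu_2)\mu_4}{(1-\mu_1)(1-\mu_2)},$$ $$\dot\mu_4=-\Gamma_1\Bigl(c\frac{\mu_1-\mu_2}{\mu_1+\mu_2-2\mu_3}+\Bigl(\frac1{1-\mu_1}-\frac1{1-\mu_2}\Bigr)\mu_3\Bigr).$$ The relative dynamics takes place in the invariant set of rank-one matrices, i.e. $\{\mu\ne0:\mu_1\mu_2-\mu_3^2-\mu_4^2=0\}$. A relative equilibrium (a rigidly rotating configuration) corresponds to a fixed point, and its stability means stability of this fixed point for the relative dynamics, in the usual Lyapunov sense (for initial conditions in this invariant set); "unstable" means not Lyapunov stable. *)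

theory Defs
  imports "HOL-Analysis.Analysis"
begin

lemma vector_4 [simp]:
  "(vector [w, x, y, z] :: 'a::zero ^ 4) $ 1 = w"
  "(vector [w, x, y, z] :: 'a::zero ^ 4) $ 2 = x"
  "(vector [w, x, y, z] :: 'a::zero ^ 4) $ 3 = y"
  "(vector [w, x, y, z] :: 'a::zero ^ 4) $ 4 = z"
  unfolding vector_def by auto


definition forward_solution ::
    "('a::real_normed_vector \<Rightarrow> 'a) \<Rightarrow> 'a set \<Rightarrow> (real \<Rightarrow> 'a) \<Rightarrow> bool" where
  "forward_solution f D x \<longleftrightarrow>
     (\<forall>t\<ge>0. x t \<in> D \<and> (x has_vector_derivative f (x t)) (at t within {0..}))"

definition fixed_point :: "('a::real_normed_vector \<Rightarrow> 'a) \<Rightarrow> 'a set \<Rightarrow> 'a \<Rightarrow> bool" where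
  "fixed_point f D p \<longleftrightarrow> p \<in> D \<and> f p = 0"

(* Lyapunov stability of the fixed point p of x' = f x on D, for initial conditions restricted
   to M: "every solution starting in M close to p is defined for all t >= 0 and stays close to p".
   Solutions of an initial value problem need not be unique for arbitrary f, hence the separate
   existence and universal clauses; for the locally Lipschitz field below they speak about the
   same unique solution. *)
definition lyapunov_stable ::
    "('a::real_normed_vector \<Rightarrow> 'a) \<Rightarrow> 'a set \<Rightarrow> 'a set \<Rightarrow> 'a \<Rightarrow> bool" where
  "lyapunov_stable f D M p \<longleftrightarrow>
     (\<forall>\<epsilon>>0. \<exists>\<delta>>0. \<forall>y \<in> D \<inter> M. dist y p < \<delta> \<longrightarrow>
        (\<exists>x. forward_solution f D x \<and> x 0 = y) \<and>
        (\<forall>x. forward_solution f D x \<and> x 0 = y \<longrightarrow> (\<forall>t\<ge>0. dist (x t) p < \<epsilon>)))"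


(* The coordinates of \<mu> are \<mu>1 = |z1|^2, \<mu>2 = |z2|^2 and \<mu>3 + i \<mu>4 = z1 * cnj z2, so that
   \<mu>1 + \<mu>2 - 2 \<mu>3 = |z1 - z2|^2 > 0 excludes collisions. *)
definition phase_space :: "(real^4) set" where
  "phase_space = {\<mu>. \<mu>$1 < 1 \<and> \<mu>$2 < 1 \<and> \<mu>$1 + \<mu>$2 - 2 * \<mu>$3 > 0}"

(* The Hermitian matrix ((\<mu>1, \<mu>3 + i \<mu>4), (\<mu>3 - i \<mu>4, \<mu>2)) has rank one. *)
definition rank_one_set :: "(real^4) set" where
  "rank_one_set = {\<mu>. \<mu> \<noteq> 0 \<and> \<mu>$1 * \<mu>$2 - (\<mu>$3)\<^sup>2 - (\<mu>$4)\<^sup>2 = 0}"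

(* \<Gamma> is the common charge of the two vortices. *)
definition vortex_field :: "real \<Rightarrow> int \<Rightarrow> real^4 \<Rightarrow> real^4" where
  "vortex_field c \<Gamma> \<mu> = vector [
      2 * c * of_int \<Gamma> * (\<mu>$4 / (\<mu>$1 + \<mu>$2 - 2 * \<mu>$3)),
      - 2 * c * of_int \<Gamma> * (\<mu>$4 / (\<mu>$1 + \<mu>$2 - 2 * \<mu>$3)),
      of_int \<Gamma> * ((\<mu>$1 - \<mu>$2) * \<mu>$4 / ((1 - \<mu>$1) * (1 - \<mu>$2))),
      - of_int \<Gamma> * (c * ((\<mu>$1 - \<mu>$2) / (\<mu>$1 + \<mu>$2 - 2 * \<mu>$3))
                    + (1 / (1 - \<mu>$1) - 1 / (1 - \<mu>$2)) * \<mu>$3)]"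

abbreviation vortex_fixed_point :: "real \<Rightarrow> int \<Rightarrow> real^4 \<Rightarrow> bool" where
  "vortex_fixed_point c \<Gamma> p \<equiv> fixed_point (vortex_field c \<Gamma>) (phase_space \<inter> rank_one_set) p"

abbreviation vortex_stable :: "real \<Rightarrow> int \<Rightarrow> real^4 \<Rightarrow> bool" where
  "vortex_stable c \<Gamma> p \<equiv> lyapunov_stable (vortex_field c \<Gamma>) phase_space rank_one_set p"

definition \<mu>0 :: "real \<Rightarrow> real \<Rightarrow> real^4" where
  "\<mu>0 r1 r2 = vector [r1\<^sup>2, r2\<^sup>2, - r1 * r2, 0]"

definition F1 :: "real \<Rightarrow> real \<Rightarrow> real" where
  "F1 r1 r2 = (r1\<^sup>2 + r2\<^sup>2)\<^sup>2
     + (r1\<^sup>2 + r2\<^sup>2) * (r1\<^sup>2 * r2\<^sup>2 + 4 * r1 * r2 - 3) + 2 * (r1 - r2)\<^sup>2"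

end

theory Submission
  imports Defs
begin

text \<open>The vortex field conserves \<open>\<mu>1 + \<mu>2\<close>, the determinant \<open>\<mu>1 \<mu>2 - \<mu>3\<^sup>2 - \<mu>4\<^sup>2\<close> and the energy
  \<open>ln ((1 - \<mu>1) (1 - \<mu>2)) - c ln (\<mu>1 + \<mu>2 - 2 \<mu>3)\<close>.  If the energy has a strict local minimum at the
  equilibrium on the surface where the first two are fixed, then the sum of the squared
  deviations of the three conserved quantities is a Lyapunov function.  In the saddle case the
  product \<open>(a - a0) \<mu>4\<close>, with \<open>a = \<mu>1 - \<mu>2\<close>, is a Chetaev function on that surface.  Under
  condition B the polynomial that governs both cases has the root \<open>r1 r2\<close>, and its derivative
  there is a negative multiple of \<open>F1\<close>, so the linearly degenerate case \<open>r1 = r2\<close> of B needs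
  no separate treatment.\<close>

subsection \<open>Solutions of autonomous differential equations\<close>

text \<open>Fix \<open>s = \<mu>1 + \<mu>2\<close> and let \<open>w = |z1 z2|\<close>. The governing
  polynomial \<open>g w = (2 - c) w^2 + s w - c (1 - s)\<close> is, up to a positive factor, the
  derivative of the energy of opposite phases with respect to \<open>w\<close>. It also drives the
  flow: the equation for \<open>\<mu>4\<close> reads
  \<open>\<mu>4' = - \<Gamma> a G / (positive)\<close>, and on the invariant surface
  \<open>G = - g (- \<mu>3)\<close> where \<open>\<mu>4 = 0\<close>. Hence one sign decides both
  stability and instability. In case A, \<open>w\<close> cannot exceed \<open>r1^2\<close> by the
  inequality of arithmetic and geometric means, so the equilibrium is an endpoint of the range of
  \<open>w\<close>, and the sign of \<open>g (r1^2) = 4 r1^4 - c (1 - r1^2)^2\<close> decides.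
  Condition B says \<open>g (r1 r2) = 0\<close>; for \<open>r1 = r2\<close> it is the borderline
  equality of A, where \<open>\<mu>4'\<close> has no linear term on the surface. For this reason
  neither Hessians nor eigenvalues are used, only signs near the equilibrium. Since stability as
  defined includes existence for all forward times, a global existence theorem is part of the
  argument.\<close>

lemma has_real_derivative_along_solution:
  fixes x :: "real \<Rightarrow> 'a::real_normed_vector" and V :: "'a \<Rightarrow> real"
  assumes "(x has_vector_derivative v) (at t within T)"
    and "(V has_derivative V') (at (x t))"
  shows "((\<lambda>s. V (x s)) has_real_derivative V' v) (at t within T)"
proof -
  have "((\<lambda>s. V (x s)) has_derivative (\<lambda>h. V' (h *\<^sub>R v))) (at t within T)"
    by (rule has_derivative_compose[OF assms(1)[unfolded has_vector_derivative_def] assms(2)])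
  moreover have "V' (h *\<^sub>R v) = V' v * h" for h
    using linear_scale[OF has_derivative_linear[OF assms(2)]] by simp
  ultimately show ?thesis
    by (simp add: has_field_derivative_def)
qed

text \<open>Mean value theorem for \<open>V\<close> along \<open>x\<close>. With
  \<open>k = 0\<close> it gives monotonicity, and applied to \<open>- V\<close> as well,
  conservation; with \<open>k > 0\<close> it gives the linear growth behind instability. The
  equation is required only up to time \<open>b\<close>, because an exit-time argument knows no more
  than that.\<close>

lemma growth_along_solution:
  fixes x :: "real \<Rightarrow> 'a::real_normed_vector" and V :: "'a \<Rightarrow> real"
  assumes "0 \<le> b"
    and x: "\<And>t. \<lbrakk>0 \<le> t; t \<le> b\<rbrakk> \<Longrightarrow> (x has_vector_derivative f (x t)) (at t within {0..})"
    and V: "\<And>t. \<lbrakk>0 \<le> t; t \<le> b\<rbrakk> \<Longrightarrow> (V has_derivative V' (x t)) (at (x t))"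
    and k: "\<And>t. \<lbrakk>0 \<le> t; t \<le> b\<rbrakk> \<Longrightarrow> k \<le> V' (x t) (f (x t))"
  shows "V (x 0) + k * b \<le> V (x b)"
proof (cases "b = 0")
  case False
  have "((\<lambda>s. V (x s)) has_derivative (*) (V' (x t) (f (x t)))) (at t within {0..b})"
    if "0 \<le> t" "t \<le> b" for t
    using has_real_derivative_along_solution[OF x[OF that] V[OF that]]
    unfolding has_field_derivative_def by (rule has_derivative_subset) auto
  then obtain t where "t \<in> {0<..<b}" "V (x b) - V (x 0) = V' (x t) (f (x t)) * b"
    using mvt_simple[of 0 b "\<lambda>s. V (x s)" "\<lambda>t. (*) (V' (x t) (f (x t)))"] False assms(1) by auto
  moreover from this have "k * b \<le> V' (x t) (f (x t)) * b"
    by (intro mult_right_mono k) auto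
  ultimately show ?thesis by (simp add: algebra_simps)
qed simp

lemma conserved_along_solution:
  fixes V :: "'a::real_normed_vector \<Rightarrow> real"
  assumes sol: "forward_solution f D x" and "0 \<le> t"
    and V: "\<And>y. y \<in> D \<Longrightarrow> (V has_derivative V' y) (at y)"
    and V': "\<And>y. y \<in> D \<Longrightarrow> V' y (f y) = 0"
  shows "V (x t) = V (x 0)"
proof (rule antisym)
  have x: "x s \<in> D" "(x has_vector_derivative f (x s)) (at s within {0..})" if "0 \<le> s" for s
    using sol that by (auto simp: forward_solution_def)
  show "V (x 0) \<le> V (x t)"
    using growth_along_solution[of t x f V V' 0] x V V' \<open>0 \<le> t\<close> by simp
  have "(\<lambda>z. - V z) (x 0) + 0 * t \<le> (\<lambda>z. - V z) (x t)"
  proof (rule growth_along_solution[where f = f and V' = "\<lambda>y h. - V' y h"])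
    show "((\<lambda>z. - V z) has_derivative (\<lambda>h. - V' (x s) h)) (at (x s))"
      if "0 \<le> s" "s \<le> t" for s
      using V[OF x(1)[OF that(1)]] by (rule has_derivative_minus)
  qed (use x V' \<open>0 \<le> t\<close> in auto)
  then show "V (x t) \<le> V (x 0)" by simp
qed

text \<open>Integrating a bound of growth \<open>exp (k * s)\<close> gains the factor
  \<open>1 / k\<close>, which later turns the Lipschitz constant \<open>L\<close> into the
  contraction constant \<open>L / k\<close>.\<close>

lemma norm_integral_le_exp:
  fixes h :: "real \<Rightarrow> 'a::banach"
  assumes "0 \<le> t" "0 < k" "continuous_on {0..t} h"
    and le: "\<And>s. \<lbrakk>0 \<le> s; s \<le> t\<rbrakk> \<Longrightarrow> norm (h s) \<le> C * exp (k * s)"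
  shows "norm (integral {0..t} h) \<le> C / k * (exp (k * t) - 1)"
proof -
  have *: "((\<lambda>s. C * exp (k * s)) has_integral (C / k * exp (k * t) - C / k * exp (k * 0))) {0..t}"
    using \<open>0 < k\<close> \<open>0 \<le> t\<close>
    by (intro fundamental_theorem_of_calculus)
       (auto intro!: derivative_eq_intros simp flip: has_real_derivative_iff_has_vector_derivative)
  have "norm (integral {0..t} h) \<le> integral {0..t} (\<lambda>s. C * exp (k * s))"
    using assms has_integral_integrable[OF *]
    by (intro integral_norm_bound_integral integrable_continuous_real) (auto intro!: continuous_intros)
  also have "\<dots> = C / k * (exp (k * t) - 1)"
    using integral_unique[OF *] by (simp add: algebra_simps)
  finally show ?thesis .
qed

text \<open>The Picard operator is conjugated by the weight \<open>exp (k t)\<close> with \<open>k = L + 1\<close>, which makes it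
  a contraction on all bounded continuous functions at once, so that no step-by-step
  continuation is needed.  Negative times are clamped to \<open>0\<close>.\<close>

lemma lipschitz_global_solution:
  fixes g :: "'a::banach \<Rightarrow> 'a"
  assumes lip: "L-lipschitz_on UNIV g"
  obtains x where "x 0 = y"
    and "\<And>t. 0 \<le> t \<Longrightarrow> (x has_vector_derivative g (x t)) (at t within {0..})"
proof -
  define k where "k = L + 1"
  have L: "0 \<le> L" and k: "0 < k" "L < k"
    using lipschitz_on_nonneg[OF lip] by (auto simp: k_def)
  \<comment> \<open>The unknown is the rescaled deviation
    \<open>\<phi> t = exp (- k * t) * (x t - y)\<close>, and \<open>X\<close> recovers the candidate
    solution from it. It stays bounded as long as \<open>x\<close> grows at most like
    \<open>exp (k * t)\<close>.\<close>
  define X where "X \<phi> t = y + exp (k * t) *\<^sub>R \<phi> t" for \<phi> :: "real \<Rightarrow> 'a" and t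
  define T where "T \<phi> t = exp (- k * t) *\<^sub>R integral {0..t} (\<lambda>s. g (X \<phi> s))" for \<phi> t
  have contg: "continuous_on A (\<lambda>s. g (h s))" if "continuous_on A h" for A h
    by (rule continuous_on_compose2[OF lipschitz_on_continuous_on[OF lip] that]) auto
  have contX: "continuous_on A (\<lambda>s. g (X (apply_bcontfun \<phi>) s))" for A \<phi>
    unfolding X_def by (intro contg continuous_intros continuous_on_apply_bcontfun)
  have bnd: "norm (exp (- k * t) *\<^sub>R integral {0..t} h) \<le> C / k"
    if "0 \<le> t" "0 \<le> C" "continuous_on {0..t} h" "\<And>s. \<lbrakk>0 \<le> s; s \<le> t\<rbrakk> \<Longrightarrow> norm (h s) \<le> C * exp (k * s)"
    for t C and h :: "real \<Rightarrow> 'a"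
  proof -
    have "norm (exp (- k * t) *\<^sub>R integral {0..t} h) \<le> exp (- k * t) * (C / k * (exp (k * t) - 1))"
      using norm_integral_le_exp[OF that(1) k(1) that(3,4)]
      unfolding norm_scaleR by (simp del: times_divide_eq_left)
    also have "\<dots> = C / k * (1 - exp (- k * t))"
      by (simp add: algebra_simps exp_minus)
    also have "\<dots> \<le> C / k * 1"
      using that k by (intro mult_left_mono) auto
    finally show ?thesis by simp
  qed
  \<comment> \<open>Derivatives and continuity are local, so the half-line may be replaced by a
    compact interval; the endpoint \<open>t + 1\<close> keeps \<open>t\<close> away from its right
    end.\<close>
  have at_Icc: "at t within {0..} = at t within {0..t + 1}" for t :: real
    by (rule at_within_nhd[where S = "{..<t + 1}"]) auto
  have bcont: "(\<lambda>t. T (apply_bcontfun \<phi>) (max 0 t)) \<in> bcontfun" for \<phi>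
  proof (rule bcontfun_normI)
    have "continuous_on {0..} (\<lambda>t. integral {0..t} (\<lambda>s. g (X (apply_bcontfun \<phi>) s)))"
      unfolding continuous_on_eq_continuous_within
    proof
      fix t :: real
      assume "t \<in> {0..}"
      then show "continuous (at t within {0..}) (\<lambda>t. integral {0..t} (\<lambda>s. g (X (apply_bcontfun \<phi>) s)))"
        using indefinite_integral_continuous_1[OF integrable_continuous_real[OF contX], of 0 "t + 1" \<phi>]
        by (auto simp: continuous_on_eq_continuous_within at_Icc)
    qed
    then have "continuous_on {0..} (T (apply_bcontfun \<phi>))"
      unfolding T_def by (intro continuous_intros)
    then show "continuous_on UNIV (\<lambda>t. T (apply_bcontfun \<phi>) (max 0 t))"
      by (rule continuous_on_compose2) (auto intro!: continuous_intros)
    fix t :: real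
    have "norm (g (X (apply_bcontfun \<phi>) s)) \<le> (norm (g y) + L * norm \<phi>) * exp (k * s)" if "0 \<le> s" for s
    proof -
      have "norm (g (X (apply_bcontfun \<phi>) s)) \<le> norm (g y) + norm (g (X (apply_bcontfun \<phi>) s) - g y)"
        by norm
      also have "norm (g (X (apply_bcontfun \<phi>) s) - g y) \<le> L * norm (exp (k * s) *\<^sub>R apply_bcontfun \<phi> s)"
        using lipschitz_on_normD[OF lip, of "X (apply_bcontfun \<phi>) s" y] by (simp add: X_def)
      also have "\<dots> \<le> L * (exp (k * s) * norm \<phi>)"
        using L norm_bounded[of \<phi> s] by (auto intro!: mult_left_mono)
      also have "norm (g y) \<le> norm (g y) * exp (k * s)"
        using that k by (simp add: mult_le_cancel_left1)
      finally show ?thesis by (simp add: algebra_simps)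
    qed
    then show "norm (T (apply_bcontfun \<phi>) (max 0 t)) \<le> (norm (g y) + L * norm \<phi>) / k"
      unfolding T_def using L by (intro bnd contX) auto
  qed
  define F where "F \<phi> = Bcontfun (\<lambda>t. T (apply_bcontfun \<phi>) (max 0 t))" for \<phi>
  have F: "apply_bcontfun (F \<phi>) t = T (apply_bcontfun \<phi>) (max 0 t)" for \<phi> t
    by (simp add: F_def Bcontfun_inverse[OF bcont])
  have "dist (F \<phi>) (F \<psi>) \<le> L / k * dist \<phi> \<psi>" for \<phi> \<psi>
  proof (rule dist_bound)
    fix t0 :: real
    define t where "t = max 0 t0"
    let ?h = "\<lambda>s. g (X (apply_bcontfun \<phi>) s) - g (X (apply_bcontfun \<psi>) s)"
    have "norm (?h s) \<le> (L * dist \<phi> \<psi>) * exp (k * s)" for s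
    proof -
      have "norm (?h s) \<le> L * norm (exp (k * s) *\<^sub>R (apply_bcontfun \<phi> s - apply_bcontfun \<psi> s))"
        using lipschitz_on_normD[OF lip, of "X (apply_bcontfun \<phi>) s" "X (apply_bcontfun \<psi>) s"]
        by (simp add: X_def scaleR_diff_right)
      also have "\<dots> \<le> L * (exp (k * s) * dist \<phi> \<psi>)"
        using L dist_bounded[of \<phi> s \<psi>] by (auto intro!: mult_left_mono simp: dist_norm)
      finally show ?thesis by (simp add: algebra_simps)
    qed
    then have "norm (exp (- k * t) *\<^sub>R integral {0..t} ?h) \<le> L * dist \<phi> \<psi> / k"
      using L by (intro bnd continuous_on_diff contX) (auto simp: t_def)
    moreover have "integral {0..t} ?h = integral {0..t} (\<lambda>s. g (X (apply_bcontfun \<phi>) s))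
        - integral {0..t} (\<lambda>s. g (X (apply_bcontfun \<psi>) s))"
      by (intro integral_diff integrable_continuous_real contX)
    ultimately show "dist (apply_bcontfun (F \<phi>) t0) (apply_bcontfun (F \<psi>) t0) \<le> L / k * dist \<phi> \<psi>"
      by (simp add: F T_def t_def dist_norm flip: scaleR_diff_right)
  qed
  then have "\<exists>!\<phi>. F \<phi> = \<phi>"
    using k L by (intro banach_fix_type[of "L / k"]) auto
  then obtain \<phi> where \<phi>: "F \<phi> = \<phi>" by auto
  define x where "x t = y + integral {0..t} (\<lambda>s. g (X (apply_bcontfun \<phi>) s))" for t
  have x: "x t = X (apply_bcontfun \<phi>) t" if "0 \<le> t" for t
  proof -
    have "apply_bcontfun \<phi> t = T (apply_bcontfun \<phi>) t"
      using F[of \<phi> t] that by (simp add: \<phi> max_def)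
    then show ?thesis
      by (simp add: x_def X_def[of _ t] T_def exp_minus)
  qed
  show thesis
  proof
    show "x 0 = y" by (simp add: x_def)
    fix t :: real
    assume t: "0 \<le> t"
    have "((\<lambda>t. integral {0..t} (\<lambda>s. g (X (apply_bcontfun \<phi>) s))) has_vector_derivative
        g (X (apply_bcontfun \<phi>) t)) (at t within {0..t + 1})"
      using t by (intro integral_has_vector_derivative contX) auto
    then have "(x has_vector_derivative g (x t)) (at t within {0..t + 1})"
      using x[OF t] unfolding x_def has_vector_derivative_def
      by (auto intro!: derivative_eq_intros)
    then show "(x has_vector_derivative g (x t)) (at t within {0..})"
      by (simp add: at_Icc)
  qed
qed

subsection \<open>The direct methods of Lyapunov and Chetaev\<close>

text \<open>At the first time the orbit reaches the sphere, \<open>V\<close> has not increased since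
  the start, where it was below \<open>m\<close>, yet it is at least \<open>m\<close> there. The
  differential equation is assumed only while the orbit is in the ball, so the argument also applies
  to solutions of a modified field that agrees with \<open>f\<close> there.\<close>

lemma lyapunov_trap:
  fixes x :: "real \<Rightarrow> 'a::real_normed_vector" and V :: "'a \<Rightarrow> real"
  assumes cont: "continuous_on {0..} x"
    and x: "\<And>t. \<lbrakk>0 \<le> t; x t \<in> cball p e\<rbrakk> \<Longrightarrow> (x has_vector_derivative f (x t)) (at t within {0..})"
    and V: "\<And>y. y \<in> cball p e \<Longrightarrow> (V has_derivative V' y) (at y)"
    and V': "\<And>y. y \<in> cball p e \<Longrightarrow> V' y (f y) \<le> 0"
    and m: "\<And>y. y \<in> sphere p e \<Longrightarrow> m \<le> V y"
    and start: "V (x 0) < m" "dist (x 0) p < e"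
    and "0 \<le> t"
  shows "dist (x t) p < e"
proof (rule ccontr)
  assume "\<not> dist (x t) p < e"
  define S where "S = {0..t} \<inter> (\<lambda>s. dist (x s) p) -` {e..}"
  have cont': "continuous_on {0..b} (\<lambda>s. dist (x s) p)" for b
    by (intro continuous_intros continuous_on_subset[OF cont]) auto
  have "closed S"
    unfolding S_def by (rule continuous_closed_preimage[OF cont']) auto
  moreover have "bounded S"
    by (rule bounded_subset[of "{0..t}"]) (auto simp: S_def)
  ultimately have "compact S"
    by (simp add: compact_eq_bounded_closed)
  moreover have "S \<noteq> {}"
    using \<open>\<not> dist (x t) p < e\<close> \<open>0 \<le> t\<close> by (auto simp: S_def)
  ultimately obtain b where b: "b \<in> S" "\<And>s. s \<in> S \<Longrightarrow> b \<le> s"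
    using compact_attains_inf[of S] by metis
  \<comment> \<open>Minimality of \<open>b\<close> only yields distance at least \<open>e\<close>;
    the intermediate value theorem gives a time up to \<open>b\<close> at distance exactly
    \<open>e\<close>, and by minimality that time is \<open>b\<close>.\<close>
  obtain s where "0 \<le> s" "s \<le> b" "dist (x s) p = e"
    using IVT'[of "\<lambda>s. dist (x s) p" 0 e b, OF _ _ _ cont'] start b(1) by (force simp: S_def)
  moreover from this have "s \<in> S"
    using b(1) by (auto simp: S_def)
  ultimately have e: "dist (x b) p = e"
    using b(2)[of s] by auto
  have inside: "x s \<in> cball p e" if "0 \<le> s" "s \<le> b" for s
  proof (cases "s = b")
    case False
    then have "s \<notin> S"
      using b(2)[of s] that by auto
    then show ?thesis
      using that b(1) by (auto simp: S_def dist_commute)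
  qed (use e in \<open>simp add: dist_commute\<close>)
  have "(\<lambda>z. - V z) (x 0) + 0 * b \<le> (\<lambda>z. - V z) (x b)"
  proof (rule growth_along_solution[where f = f and V' = "\<lambda>y h. - V' y h"])
    show "((\<lambda>z. - V z) has_derivative (\<lambda>h. - V' (x s) h)) (at (x s))"
      if "0 \<le> s" "s \<le> b" for s
      using V[OF inside[OF that]] by (rule has_derivative_minus)
  qed (use x V' inside b(1) in \<open>auto simp: S_def\<close>)
  with m[of "x b"] e start show False
    by (simp add: dist_commute)
qed

text \<open>For the existence clause, \<open>f\<close> is composed with the nearest-point projection
  onto a closed ball around \<open>p\<close>. The projection is 1-Lipschitz, so the composite is
  globally Lipschitz and has a global solution; trapping confines that solution to the ball, where
  the composite is \<open>f\<close> itself.\<close>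

theorem lyapunov_direct_method:
  fixes f :: "'a::euclidean_space \<Rightarrow> 'a" and V :: "'a \<Rightarrow> real"
  assumes "0 < \<rho>" and D: "cball p \<rho> \<subseteq> D" and lip: "L-lipschitz_on (cball p \<rho>) f"
    and V: "\<And>y. y \<in> cball p \<rho> \<Longrightarrow> (V has_derivative V' y) (at y)"
    and V': "\<And>y. y \<in> cball p \<rho> \<Longrightarrow> V' y (f y) \<le> 0"
    and min: "\<And>y. \<lbrakk>y \<in> cball p \<rho>; y \<noteq> p\<rbrakk> \<Longrightarrow> V p < V y"
  shows "lyapunov_stable f D M p"
  unfolding lyapunov_stable_def
proof (intro allI impI)
  fix \<epsilon> :: real
  assume "0 < \<epsilon>"
  define e where "e = min \<epsilon> \<rho>"
  have e: "0 < e" "e \<le> \<epsilon>" "cball p e \<subseteq> cball p \<rho>"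
    using \<open>0 < \<epsilon>\<close> \<open>0 < \<rho>\<close> by (auto simp: e_def)
  have contV: "continuous_on (cball p \<rho>) V"
    using V by (auto intro!: continuous_at_imp_continuous_on has_derivative_continuous)
  obtain m where m: "V p < m" "\<And>y. y \<in> sphere p e \<Longrightarrow> m \<le> V y"
  proof -
    have "sphere p e \<noteq> {}"
      using e by simp
    moreover have "continuous_on (sphere p e) V"
      using e by (intro continuous_on_subset[OF contV]) auto
    ultimately obtain z where "z \<in> sphere p e" "\<And>y. y \<in> sphere p e \<Longrightarrow> V z \<le> V y"
      using continuous_attains_inf[of "sphere p e" V] by auto
    then show thesis
      using that[of "V z"] min[of z] e by auto
  qed
  have "\<forall>\<^sub>F y in nhds p. V y < m"
    using V[of p] \<open>0 < \<rho>\<close> m(1)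
    by (intro order_tendstoD(2)[where y = "V p"])
       (auto simp: tendsto_at_iff_tendsto_nhds[symmetric] dest!: has_derivative_continuous simp: continuous_within)
  then obtain d where d: "0 < d" "\<And>y. dist y p < d \<Longrightarrow> V y < m"
    by (auto simp: eventually_nhds_metric)
  note trap = lyapunov_trap[where f = f and V = V and V' = V' and p = p and e = e and m = m]
  show "\<exists>\<delta>>0. \<forall>y\<in>D \<inter> M. dist y p < \<delta> \<longrightarrow>
      (\<exists>x. forward_solution f D x \<and> x 0 = y) \<and>
      (\<forall>x. forward_solution f D x \<and> x 0 = y \<longrightarrow> (\<forall>t\<ge>0. dist (x t) p < \<epsilon>))"
  proof (intro exI[of _ "min d e"] conjI ballI impI allI)
    fix y
    assume "dist y p < min d e"
    then have y: "dist y p < e" "V y < m"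
      using d by auto
    {
      fix x t
      assume "forward_solution f D x \<and> x 0 = y" "0 \<le> (t::real)"
      then have sol: "(x has_vector_derivative f (x s)) (at s within {0..})" if "0 \<le> s" for s
        using that by (auto simp: forward_solution_def)
      have "continuous_on {0..} x"
        using sol by (auto simp: continuous_on_eq_continuous_within has_vector_derivative_def
            intro!: has_derivative_continuous)
      then have "dist (x t) p < e"
        by (rule trap) (use sol V V' e m y \<open>forward_solution f D x \<and> x 0 = y\<close> \<open>0 \<le> t\<close> in auto)
      then show "dist (x t) p < \<epsilon>"
        using e(2) by simp
    }
    define g where "g = (\<lambda>z. f (closest_point (cball p e) z))"
    have "1-lipschitz_on UNIV (closest_point (cball p e))"
      using e by (intro lipschitz_onI) (auto intro!: closest_point_lipschitz)
    moreover have "range (closest_point (cball p e)) \<subseteq> cball p e"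
      using e closest_point_in_set[of "cball p e"] by auto
    ultimately have "(L * 1)-lipschitz_on UNIV g"
      unfolding g_def using lip e
      by (intro lipschitz_on_compose2) (auto intro: lipschitz_on_subset)
    then obtain x where x: "x 0 = y"
      "\<And>t. 0 \<le> t \<Longrightarrow> (x has_vector_derivative g (x t)) (at t within {0..})"
      by (rule lipschitz_global_solution[of _ _ y]) blast
    have g: "g z = f z" if "z \<in> cball p e" for z
      using that by (simp add: g_def closest_point_self)
    have "continuous_on {0..} x"
      using x(2) by (auto simp: continuous_on_eq_continuous_within has_vector_derivative_def
          intro!: has_derivative_continuous)
    moreover have "(x has_vector_derivative f (x t)) (at t within {0..})"
      if "0 \<le> t" "x t \<in> cball p e" for t
      using x(2)[of t] that g by simp
    ultimately have inside: "dist (x t) p < e" if "0 \<le> t" for t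
      by (rule trap) (use V V' e m y x(1) that in auto)
    have "x t \<in> cball p e" if "0 \<le> t" for t
      using inside[OF that] by (simp add: dist_commute)
    then have "forward_solution f D x"
      unfolding forward_solution_def using x(2) g D e(3) by force
    then show "\<exists>x. forward_solution f D x \<and> x 0 = y"
      using x(1) by blast
  qed (use d e in auto)
qed

text \<open>If \<open>p\<close> were stable, some orbit in \<open>S\<close> starting near
  \<open>p\<close> with \<open>W > 0\<close> would exist for all time and stay in the ball. Along it
  \<open>W\<close> does not decrease, so it remains in the compact set \<open>K\<close> where
  \<open>W\<close> is at least its initial value. There the derivative of \<open>W\<close> has a
  positive minimum, so \<open>W\<close> grows linearly, although it is bounded on a compact
  set.\<close>

theorem chetaev_instability:
  fixes f :: "'a::{real_normed_vector, heine_borel} \<Rightarrow> 'a" and W :: "'a \<Rightarrow> real"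
  assumes "0 < \<rho>" and S: "closed S" "S \<inter> cball p \<rho> \<subseteq> D \<inter> M"
    and invariant: "\<And>x t. \<lbrakk>forward_solution f D x; x 0 \<in> S; 0 \<le> t\<rbrakk> \<Longrightarrow> x t \<in> S"
    and W: "\<And>y. y \<in> S \<inter> cball p \<rho> \<Longrightarrow> (W has_derivative W' y) (at y)"
    and cont: "continuous_on (S \<inter> cball p \<rho>) (\<lambda>y. W' y (f y))"
    and nonneg: "\<And>y. y \<in> S \<inter> cball p \<rho> \<Longrightarrow> 0 \<le> W' y (f y)"
    and pos: "\<And>y. \<lbrakk>y \<in> S \<inter> cball p \<rho>; 0 < W y\<rbrakk> \<Longrightarrow> 0 < W' y (f y)"
    and near: "\<And>\<delta>. 0 < \<delta> \<Longrightarrow> \<exists>y\<in>S. dist y p < \<delta> \<and> 0 < W y"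
  shows "\<not> lyapunov_stable f D M p"
proof
  assume "lyapunov_stable f D M p"
  then have "\<exists>\<delta>>0. \<forall>y \<in> D \<inter> M. dist y p < \<delta> \<longrightarrow>
        (\<exists>x. forward_solution f D x \<and> x 0 = y) \<and>
        (\<forall>x. forward_solution f D x \<and> x 0 = y \<longrightarrow> (\<forall>t\<ge>0. dist (x t) p < \<rho>))"
    unfolding lyapunov_stable_def by (rule allE[of _ \<rho>]) (use \<open>0 < \<rho>\<close> in simp)
  then obtain \<delta> where "0 < \<delta>" and \<delta>: "\<And>y. y \<in> D \<inter> M \<Longrightarrow> dist y p < \<delta> \<Longrightarrow>
        (\<exists>x. forward_solution f D x \<and> x 0 = y) \<and>
        (\<forall>x. forward_solution f D x \<and> x 0 = y \<longrightarrow> (\<forall>t\<ge>0. dist (x t) p < \<rho>))"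
    by auto
  obtain y where y: "y \<in> S" "dist y p < min \<delta> \<rho>" "0 < W y"
    using near[of "min \<delta> \<rho>"] \<open>0 < \<delta>\<close> \<open>0 < \<rho>\<close> by auto
  then have yS: "y \<in> S \<inter> cball p \<rho>"
    by (auto simp: dist_commute)
  then have "y \<in> D \<inter> M"
    using S(2) by blast
  with \<delta>[of y] y(2) obtain x where x: "forward_solution f D x" "x 0 = y"
    and "\<forall>t\<ge>0. dist (x t) p < \<rho>"
    by auto
  with invariant[OF x(1)] y(1) have inside: "x t \<in> S \<inter> cball p \<rho>" if "0 \<le> t" for t
    using that by (auto simp: dist_commute less_imp_le)
  have sol: "(x has_vector_derivative f (x t)) (at t within {0..})" if "0 \<le> t" for t
    using x(1) that by (auto simp: forward_solution_def)
  have contW: "continuous_on (S \<inter> cball p \<rho>) W"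
    using has_derivative_continuous[OF W] by (auto intro: continuous_at_imp_continuous_on)
  have cpt: "compact (S \<inter> cball p \<rho>)"
    using S(1) by (intro closed_Int_compact) auto
  define K where "K = (S \<inter> cball p \<rho>) \<inter> W -` {W y..}"
  have "closed K"
    unfolding K_def using contW S(1) by (intro continuous_closed_preimage) auto
  then have "compact K"
    using compact_Int_closed[OF cpt, of K] Int_absorb1[of K "S \<inter> cball p \<rho>"] by (auto simp: K_def)
  moreover have "continuous_on K (\<lambda>y. W' y (f y))" "y \<in> K"
    using yS by (auto simp: K_def intro: continuous_on_subset[OF cont])
  ultimately obtain z where z: "z \<in> K" "\<And>u. u \<in> K \<Longrightarrow> W' z (f z) \<le> W' u (f u)"
    using continuous_attains_inf[of K "\<lambda>y. W' y (f y)"] by blast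
  define k where "k = W' z (f z)"
  have "0 < k"
    using z(1) y(3) by (auto simp: k_def K_def intro!: pos)
  have "x t \<in> K" if "0 \<le> t" for t
    using growth_along_solution[of t x f W W' 0] sol W nonneg inside that x(2)
    by (auto simp: K_def)
  then have "W y + k * t \<le> W (x t)" if "0 \<le> t" for t
    using growth_along_solution[of t x f W W' k] sol W inside that x(2) z(2)
    by (auto simp: k_def)
  moreover obtain B where "\<And>u. u \<in> S \<inter> cball p \<rho> \<Longrightarrow> W u \<le> B"
    using continuous_attains_sup[OF cpt _ contW] yS by blast
  ultimately have B: "W y + k * t \<le> B" if "0 \<le> t" for t
    using inside[OF that] that by (metis order_trans)
  \<comment> \<open>At the time \<open>(B + 1 - W y) / k\<close> the linear lower bound equals
    \<open>B + 1\<close>; the instance at \<open>0\<close> gives \<open>W y \<le> B\<close>, so this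
    time is nonnegative.\<close>
  from B[of 0] B[of "(B + 1 - W y) / k"] \<open>0 < k\<close> show False
    by simp
qed

subsection \<open>Locally Lipschitz functions\<close>

text \<open>Stated for all sufficiently small radii, so that it can be intersected with other
  neighbourhood conditions by filter reasoning until one common ball serves them all.\<close>

definition lipschitz_near :: "('a::metric_space \<Rightarrow> 'b::metric_space) \<Rightarrow> 'a \<Rightarrow> bool" where
  "lipschitz_near f p \<longleftrightarrow> (\<forall>\<^sub>F r in at_right 0. \<exists>L. L-lipschitz_on (cball p r) f)"

lemma lipschitz_near_const: "lipschitz_near (\<lambda>x. k) p"
  unfolding lipschitz_near_def by (intro always_eventually allI exI) (rule lipschitz_on_constant)

lemma lipschitz_near_add:
  fixes f g :: "'a::metric_space \<Rightarrow> 'b::real_normed_vector"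
  assumes "lipschitz_near f p" "lipschitz_near g p"
  shows "lipschitz_near (\<lambda>x. f x + g x) p"
  using assms unfolding lipschitz_near_def
  by eventually_elim (auto intro: lipschitz_on_add)

lemma lipschitz_near_minus:
  fixes f :: "'a::metric_space \<Rightarrow> 'b::real_normed_vector"
  assumes "lipschitz_near f p"
  shows "lipschitz_near (\<lambda>x. - f x) p"
  using assms unfolding lipschitz_near_def
  by eventually_elim (auto intro: lipschitz_on_minus)

lemma lipschitz_near_diff:
  fixes f g :: "'a::metric_space \<Rightarrow> 'b::real_normed_vector"
  assumes "lipschitz_near f p" "lipschitz_near g p"
  shows "lipschitz_near (\<lambda>x. f x - g x) p"
  using assms unfolding lipschitz_near_def
  by eventually_elim (auto intro: lipschitz_on_diff)

lemma lipschitz_near_mult: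
  fixes f g :: "'a::metric_space \<Rightarrow> 'b::real_normed_algebra"
  assumes "lipschitz_near f p" "lipschitz_near g p"
  shows "lipschitz_near (\<lambda>x. f x * g x) p"
  using assms eventually_at_right_less[of 0] unfolding lipschitz_near_def
proof eventually_elim
  case (elim r)
  then obtain L M where L: "L-lipschitz_on (cball p r) f" and M: "M-lipschitz_on (cball p r) g"
    by blast
  have bound: "norm (h y) \<le> norm (h p) + K * r"
    if "K-lipschitz_on (cball p r) h" "y \<in> cball p r" for h :: "'a \<Rightarrow> 'b" and K y
  proof -
    have "dist (h y) (h p) \<le> K * dist y p"
      using lipschitz_onD[OF that(1)] that(2) elim by auto
    also have "\<dots> \<le> K * r"
      using that lipschitz_on_nonneg[OF that(1)] by (auto intro!: mult_left_mono simp: dist_commute)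
    finally show ?thesis
      using norm_triangle_sub[of "h y" "h p"] by (simp add: dist_norm)
  qed
  define A where "A = norm (f p) + L * r"
  define B where "B = norm (g p) + M * r"
  have "0 \<le> A" "0 \<le> B"
    using lipschitz_on_nonneg[OF L] lipschitz_on_nonneg[OF M] elim by (auto simp: A_def B_def)
  have "(A * M + L * B)-lipschitz_on (cball p r) (\<lambda>x. f x * g x)"
  proof (rule lipschitz_onI)
    fix y z
    assume y: "y \<in> cball p r" and z: "z \<in> cball p r"
    have "norm (f y * g y - f z * g z) = norm (f y * (g y - g z) + (f y - f z) * g z)"
      by (simp add: algebra_simps)
    also have "\<dots> \<le> norm (f y) * norm (g y - g z) + norm (f y - f z) * norm (g z)"
      by (meson norm_add_leD norm_mult_ineq norm_triangle_mono)
    also have "\<dots> \<le> A * (M * dist y z) + (L * dist y z) * B"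
      using bound[OF L y] bound[OF M z] lipschitz_onD[OF L y z] lipschitz_onD[OF M y z] \<open>0 \<le> A\<close>
        lipschitz_on_nonneg[OF L]
      by (intro add_mono mult_mono) (auto simp: A_def B_def dist_norm)
    finally show "dist (f y * g y) (f z * g z) \<le> (A * M + L * B) * dist y z"
      by (simp add: dist_norm algebra_simps)
  qed (use \<open>0 \<le> A\<close> \<open>0 \<le> B\<close> lipschitz_on_nonneg[OF L] lipschitz_on_nonneg[OF M] in auto)
  then show ?case by blast
qed

lemma lipschitz_near_inverse:
  fixes f :: "'a::metric_space \<Rightarrow> 'b::real_normed_field"
  assumes "lipschitz_near f p" "f p \<noteq> 0"
  shows "lipschitz_near (\<lambda>x. inverse (f x)) p"
proof -
  define k where "k = norm (f p) / 2"
  have "0 < k" using assms(2) by (simp add: k_def)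
  obtain r0 L0 where r0: "0 < r0" "L0-lipschitz_on (cball p r0) f"
    using assms(1) unfolding lipschitz_near_def eventually_at_right_field
    by (metis dense)
  have "continuous_on (ball p r0) f"
    using lipschitz_on_continuous_on[OF r0(2)] by (rule continuous_on_subset) auto
  then have "isCont f p"
    using \<open>0 < r0\<close> by (simp add: continuous_on_eq_continuous_at)
  then have "((\<lambda>x. norm (f x)) \<longlongrightarrow> norm (f p)) (nhds p)"
    by (auto simp: continuous_at tendsto_at_iff_tendsto_nhds intro: tendsto_norm)
  then have "\<forall>\<^sub>F x in nhds p. k < norm (f x)"
    by (rule order_tendstoD) (use assms(2) in \<open>simp add: k_def\<close>)
  then obtain d where d: "0 < d" "\<And>x. dist x p < d \<Longrightarrow> k < norm (f x)"
    by (auto simp: eventually_nhds_metric)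
  have "\<forall>\<^sub>F r in at_right 0. r < d"
    using eventually_at_right_real[OF d(1)] by eventually_elim simp
  with assms(1) show ?thesis
    unfolding lipschitz_near_def
  proof eventually_elim
    case (elim r)
    then obtain L where L: "L-lipschitz_on (cball p r) f" by blast
    have "(L / (k * k))-lipschitz_on (cball p r) (\<lambda>x. inverse (f x))"
    proof (rule lipschitz_onI)
      fix y z
      assume y: "y \<in> cball p r" and z: "z \<in> cball p r"
      then have *: "k < norm (f y)" "k < norm (f z)"
        using elim by (auto intro!: d simp: dist_commute)
      with \<open>0 < k\<close> have "f y \<noteq> 0" "f z \<noteq> 0" by auto
      then have "inverse (f y) - inverse (f z) = (f z - f y) / (f y * f z)"
        by (simp add: field_simps)
      then have "dist (inverse (f y)) (inverse (f z)) = norm (f y - f z) / (norm (f y) * norm (f z))"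
        by (simp add: dist_norm norm_divide norm_mult norm_minus_commute)
      also have "\<dots> \<le> (L * dist y z) / (k * k)"
        using lipschitz_onD[OF L y z] * \<open>0 < k\<close>
        by (intro frac_le mult_mono) (auto simp: dist_norm intro: order_trans[OF norm_ge_zero])
      finally show "dist (inverse (f y)) (inverse (f z)) \<le> L / (k * k) * dist y z"
        by simp
    qed (use lipschitz_on_nonneg[OF L] \<open>0 < k\<close> in auto)
    then show ?case by blast
  qed
qed

lemma lipschitz_near_divide:
  fixes f g :: "'a::metric_space \<Rightarrow> 'b::real_normed_field"
  assumes "lipschitz_near f p" "lipschitz_near g p" "g p \<noteq> 0"
  shows "lipschitz_near (\<lambda>x. f x / g x) p"
  unfolding divide_inverse by (intro lipschitz_near_mult lipschitz_near_inverse assms)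

lemma lipschitz_near_vec_nth: "lipschitz_near (\<lambda>x::real^'n. x $ i) p"
  unfolding lipschitz_near_def
  by (intro always_eventually allI exI[of _ 1] lipschitz_onI) (simp_all add: dist_vec_nth_le)

lemma lipschitz_near_vec:
  fixes f :: "'a::metric_space \<Rightarrow> real^'n"
  assumes "\<And>i. lipschitz_near (\<lambda>x. f x $ i) p"
  shows "lipschitz_near f p"
proof -
  have "\<forall>\<^sub>F r in at_right 0. \<forall>i. \<exists>L. L-lipschitz_on (cball p r) (\<lambda>x. f x $ i)"
    using assms unfolding lipschitz_near_def by (rule eventually_all_finite)
  then show ?thesis
    unfolding lipschitz_near_def
  proof eventually_elim
    case (elim r)
    then obtain L where L: "\<And>i. (L i)-lipschitz_on (cball p r) (\<lambda>x. f x $ i)" by metis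
    have "(\<Sum>i\<in>UNIV. L i)-lipschitz_on (cball p r) f"
    proof (rule lipschitz_onI)
      fix y z
      assume "y \<in> cball p r" "z \<in> cball p r"
      then have "(\<Sum>i\<in>UNIV. \<bar>(f y - f z) $ i\<bar>) \<le> (\<Sum>i\<in>UNIV. L i * dist y z)"
        using lipschitz_onD[OF L] by (intro sum_mono) (auto simp: dist_real_def)
      then show "dist (f y) (f z) \<le> (\<Sum>i\<in>UNIV. L i) * dist y z"
        using norm_le_l1_cart[of "f y - f z"] by (simp add: dist_norm sum_distrib_right)
    qed (use lipschitz_on_nonneg[OF L] in \<open>auto intro: sum_nonneg\<close>)
    then show ?case by blast
  qed
qed

lemmas lipschitz_near_intros = lipschitz_near_const lipschitz_near_add lipschitz_near_minus
  lipschitz_near_diff lipschitz_near_mult lipschitz_near_divide lipschitz_near_vec_nth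

lemma lipschitz_near_vortex_field:
  assumes "p \<in> phase_space"
  shows "lipschitz_near (vortex_field c \<Gamma>) p"
proof (rule lipschitz_near_vec)
  fix i :: 4
  have nz: "p $ 1 + p $ 2 - 2 * p $ 3 \<noteq> 0" "1 - p $ 1 \<noteq> 0" "1 - p $ 2 \<noteq> 0"
    using assms by (auto simp: phase_space_def)
  then have "(1 - p $ 1) * (1 - p $ 2) \<noteq> 0" by simp
  with nz have "\<forall>i. lipschitz_near (\<lambda>x. vortex_field c \<Gamma> x $ i) p"
    unfolding forall_4 vortex_field_def vector_4 by (intro conjI lipschitz_near_intros)
  then show "lipschitz_near (\<lambda>x. vortex_field c \<Gamma> x $ i) p" by blast
qed

subsection \<open>Conserved quantities\<close>

definition impulse :: "real^4 \<Rightarrow> real" where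
  "impulse \<mu> = \<mu>$1 + \<mu>$2"

definition casimir :: "real^4 \<Rightarrow> real" where
  "casimir \<mu> = \<mu>$1 * \<mu>$2 - (\<mu>$3)\<^sup>2 - (\<mu>$4)\<^sup>2"

definition energy :: "real \<Rightarrow> real^4 \<Rightarrow> real" where
  "energy c \<mu> = ln (1 - \<mu>$1) + ln (1 - \<mu>$2) - c * ln (\<mu>$1 + \<mu>$2 - 2 * \<mu>$3)"

definition casimir_deriv :: "real^4 \<Rightarrow> real^4 \<Rightarrow> real" where
  "casimir_deriv \<mu> h = h$1 * \<mu>$2 + \<mu>$1 * h$2 - 2 * \<mu>$3 * h$3 - 2 * \<mu>$4 * h$4"

definition energy_deriv :: "real \<Rightarrow> real^4 \<Rightarrow> real^4 \<Rightarrow> real" where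
  "energy_deriv c \<mu> h = - h$1 / (1 - \<mu>$1) - h$2 / (1 - \<mu>$2)
     - c * (h$1 + h$2 - 2 * h$3) / (\<mu>$1 + \<mu>$2 - 2 * \<mu>$3)"

lemmas has_derivative_vec_nth [derivative_intros] = bounded_linear.has_derivative[OF bounded_linear_vec_nth]

lemma impulse_has_derivative: "(impulse has_derivative impulse) (at \<mu>)"
  unfolding impulse_def by (auto intro!: derivative_eq_intros)

lemma casimir_has_derivative: "(casimir has_derivative casimir_deriv \<mu>) (at \<mu>)"
  unfolding casimir_def casimir_deriv_def
  by (auto intro!: derivative_eq_intros simp: power2_eq_square algebra_simps)

lemma energy_has_derivative:
  assumes "\<mu> \<in> phase_space"
  shows "(energy c has_derivative energy_deriv c \<mu>) (at \<mu>)"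
proof -
  have "0 < 1 - \<mu>$1" "0 < 1 - \<mu>$2" "0 < \<mu>$1 + \<mu>$2 - 2 * \<mu>$3"
    using assms by (auto simp: phase_space_def)
  then show ?thesis
    unfolding energy_def energy_deriv_def
    by (auto intro!: derivative_eq_intros simp: fun_eq_iff field_simps)
qed

lemma impulse_vortex_field: "impulse (vortex_field c \<Gamma> \<mu>) = 0"
  by (simp add: impulse_def vortex_field_def)

lemma
  assumes "\<mu> \<in> phase_space"
  shows casimir_vortex_field: "casimir_deriv \<mu> (vortex_field c \<Gamma> \<mu>) = 0"
    and energy_vortex_field: "energy_deriv c \<mu> (vortex_field c \<Gamma> \<mu>) = 0"
proof -
  \<comment> \<open>With the three denominators as atoms, both identities become rational identities
    that clearing denominators settles.\<close>
  define u v s where "u = 1 - \<mu>$1" and "v = 1 - \<mu>$2" and "s = \<mu>$1 + \<mu>$2 - 2 * \<mu>$3"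
  have nz: "u \<noteq> 0" "v \<noteq> 0" "s \<noteq> 0"
    using assms by (auto simp: phase_space_def u_def v_def s_def)
  have \<mu>: "\<mu>$1 = 1 - u" "\<mu>$2 = 1 - v"
    by (auto simp: u_def v_def)
  show "casimir_deriv \<mu> (vortex_field c \<Gamma> \<mu>) = 0"
    using nz unfolding casimir_deriv_def vortex_field_def vector_4
      u_def[symmetric] v_def[symmetric] s_def[symmetric] \<mu>
    by (simp add: divide_simps) (simp add: algebra_simps)
  show "energy_deriv c \<mu> (vortex_field c \<Gamma> \<mu>) = 0"
    using nz unfolding energy_deriv_def vortex_field_def vector_4
      u_def[symmetric] v_def[symmetric] s_def[symmetric] \<mu>
    by (simp add: divide_simps) (simp add: algebra_simps)
qed

subsection \<open>Stability\<close>

lemma open_phase_space: "open phase_space"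
proof -
  have "phase_space = {\<mu>. \<mu>$1 < 1} \<inter> {\<mu>. \<mu>$2 < 1} \<inter> {\<mu>. 0 < \<mu>$1 + \<mu>$2 - 2 * \<mu>$3}"
    by (auto simp: phase_space_def)
  also have "open \<dots>"
    by (intro open_Int open_Collect_less continuous_intros)
  finally show ?thesis .
qed

lemma eventually_cball_at_right_0:
  fixes p :: "'a::metric_space"
  assumes "\<forall>\<^sub>F y in nhds p. P y"
  shows "\<forall>\<^sub>F r in at_right 0. \<forall>y\<in>cball p r. P y"
proof -
  obtain d where d: "0 < d" "\<And>y. dist y p < d \<Longrightarrow> P y"
    using assms by (auto simp: eventually_nhds_metric)
  show ?thesis
    using eventually_at_right_real[OF d(1)]
    by eventually_elim (auto intro!: d(2) simp: dist_commute)
qed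

text \<open>\<open>V\<close> is conserved, and \<open>V y = 0\<close> forces all three conserved
  quantities to agree with those of \<open>p\<close>. Positivity near \<open>p\<close> therefore
  amounts to \<open>p\<close> being isolated in their common level set, which admits degenerate
  minima. Perturbations that leave the surface are covered because \<open>V\<close> measures them
  too.\<close>

lemma vortex_stable_if_isolated:
  assumes p: "p \<in> phase_space"
    and isolated: "\<forall>\<^sub>F y in nhds p. impulse y = impulse p \<and> casimir y = casimir p \<and> energy c y = energy c p
                     \<longrightarrow> y = p"
  shows "lyapunov_stable (vortex_field c \<Gamma>) phase_space M p"
proof -
  define V where "V y = (impulse y - impulse p)\<^sup>2 + (casimir y - casimir p)\<^sup>2 + (energy c y - energy c p)\<^sup>2" for y
  define V' where "V' y h = 2 * (impulse y - impulse p) * impulse h + 2 * (casimir y - casimir p) * casimir_deriv y h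
    + 2 * (energy c y - energy c p) * energy_deriv c y h" for y h
  have V: "(V has_derivative V' y) (at y)" if "y \<in> phase_space" for y
    unfolding V_def V'_def
    by (auto intro!: derivative_eq_intros impulse_has_derivative casimir_has_derivative
        energy_has_derivative[OF that] simp: algebra_simps)
  have "\<forall>\<^sub>F y in nhds p. y \<in> phase_space"
    using open_phase_space p by (rule eventually_nhds_in_open)
  then have "\<forall>\<^sub>F r in at_right 0. \<forall>y\<in>cball p r. y \<in> phase_space"
    by (rule eventually_cball_at_right_0)
  with eventually_cball_at_right_0[OF isolated] lipschitz_near_vortex_field[OF p, of c \<Gamma>]
    eventually_at_right_less[of 0]
  have "\<forall>\<^sub>F r in at_right 0. 0 < r \<and> (\<exists>L. L-lipschitz_on (cball p r) (vortex_field c \<Gamma>)) \<and>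
      (\<forall>y\<in>cball p r. y \<in> phase_space) \<and> (\<forall>y\<in>cball p r.
        impulse y = impulse p \<and> casimir y = casimir p \<and> energy c y = energy c p \<longrightarrow> y = p)"
    unfolding lipschitz_near_def by eventually_elim blast
  then obtain r L where r: "0 < r" and L: "L-lipschitz_on (cball p r) (vortex_field c \<Gamma>)"
    and sub: "\<forall>y\<in>cball p r. y \<in> phase_space"
    and iso: "\<forall>y\<in>cball p r. impulse y = impulse p \<and> casimir y = casimir p \<and> energy c y = energy c p \<longrightarrow> y = p"
    using eventually_happens'[OF trivial_limit_at_right_real] by blast
  show ?thesis
  proof (rule lyapunov_direct_method[OF r _ L])
    show "cball p r \<subseteq> phase_space"
      using sub by blast
    fix y
    assume y: "y \<in> cball p r"
    then show "(V has_derivative V' y) (at y)"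
      using sub V by blast
    show "V' y (vortex_field c \<Gamma> y) \<le> 0"
      using sub y by (simp add: V'_def impulse_vortex_field casimir_vortex_field energy_vortex_field)
    assume "y \<noteq> p"
    then have "\<not> (impulse y = impulse p \<and> casimir y = casimir p \<and> energy c y = energy c p)"
      using iso y by blast
    then show "V p < V y"
      by (auto simp: V_def less_le add_nonneg_eq_0_iff)
  qed
qed

text \<open>The comparison is with one point \<open>w\<close> on either side of \<open>m\<close>, so
  it covers a minimum at the end of the admissible range as well as an interior one.\<close>

lemma strict_min_if_deriv_sign:
  fixes h :: "real \<Rightarrow> real"
  assumes "w \<noteq> m"
    and deriv: "\<And>v. \<lbrakk>min m w \<le> v; v \<le> max m w\<rbrakk> \<Longrightarrow> (h has_real_derivative h' v) (at v)"
    and sign: "\<And>v. \<lbrakk>min m w < v; v < max m w\<rbrakk> \<Longrightarrow> 0 < (w - m) * h' v"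
  shows "h m < h w"
proof -
  have "min m w < max m w"
    using assms(1) by (auto simp: min_def max_def)
  from MVT2[OF this deriv] obtain v where v: "min m w < v" "v < max m w"
    and "h (max m w) - h (min m w) = (max m w - min m w) * h' v"
    by blast
  then have "h w - h m = (w - m) * h' v"
    by (cases "w < m") (auto simp: min_def max_def algebra_simps split: if_splits)
  with sign[OF v] show ?thesis by simp
qed

lemma \<mu>0_nth [simp]:
  "\<mu>0 r1 r2 $ 1 = r1\<^sup>2" "\<mu>0 r1 r2 $ 2 = r2\<^sup>2" "\<mu>0 r1 r2 $ 3 = - r1 * r2" "\<mu>0 r1 r2 $ 4 = 0"
  unfolding \<mu>0_def by simp_all

lemma impulse_\<mu>0 [simp]: "impulse (\<mu>0 r1 r2) = r1\<^sup>2 + r2\<^sup>2"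
  by (simp add: impulse_def)

lemma casimir_\<mu>0 [simp]: "casimir (\<mu>0 r1 r2) = 0"
  by (simp add: casimir_def power_mult_distrib)

lemma \<mu>0_in_phase_space:
  assumes "0 \<le> r1" "r1 < 1" "0 \<le> r2" "r2 < 1" "0 < r1 + r2"
  shows "\<mu>0 r1 r2 \<in> phase_space"
proof -
  have "r1\<^sup>2 + r2\<^sup>2 + 2 * (r1 * r2) = (r1 + r2)\<^sup>2"
    by (simp add: power2_eq_square algebra_simps)
  moreover have "0 < (r1 + r2)\<^sup>2"
    using assms by simp
  ultimately have "0 < r1\<^sup>2 + r2\<^sup>2 - 2 * (- r1 * r2)"
    by simp
  then show ?thesis
    using assms by (simp add: phase_space_def power_less_one_iff)
qed

text \<open>On the invariant surface through \<open>\<mu>0 r1 r2\<close> put \<open>w = |z1 z2|\<close>, so that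
  \<open>\<mu>3\<^sup>2 + \<mu>4\<^sup>2 = w\<^sup>2\<close> and \<open>\<mu>3 \<ge> - w\<close>.  The energy is then at least \<open>h w\<close>, its value for
  opposite phases, and \<open>h'\<close> has the sign of the quadratic polynomial in \<open>w\<close> below.\<close>

lemma vortex_stable_if_sign:
  assumes "0 < c" and r: "0 < r1" "r1 < 1" "0 < r2" "r2 < 1"
    and sign: "\<forall>\<^sub>F w in nhds (r1 * r2). w \<noteq> r1 * r2 \<and> (r1 = r2 \<longrightarrow> w < r1 * r2) \<longrightarrow>
       0 < (w - r1 * r2) * ((2 - c) * w\<^sup>2 + (r1\<^sup>2 + r2\<^sup>2) * w - c * (1 - (r1\<^sup>2 + r2\<^sup>2)))"
  shows "vortex_stable c \<Gamma> (\<mu>0 r1 r2)"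
proof (rule vortex_stable_if_isolated)
  let ?p = "\<mu>0 r1 r2"
  define s where "s = r1\<^sup>2 + r2\<^sup>2"
  define m where "m = r1 * r2"
  define g where "g w = (2 - c) * w\<^sup>2 + s * w - c * (1 - s)" for w
  define h where "h w = ln (1 - s + w\<^sup>2) - c * ln (s + 2 * w)" for w
  define h' where "h' w = 2 * g w / ((1 - s + w\<^sup>2) * (s + 2 * w))" for w
  have m: "0 < m" and s: "0 < s"
    using r by (auto simp: m_def s_def intro!: add_pos_pos)
  have P0: "1 - s + m\<^sup>2 = (1 - r1\<^sup>2) * (1 - r2\<^sup>2)"
    by (simp add: s_def m_def power_mult_distrib algebra_simps)
  have sq: "r1\<^sup>2 < 1" "r2\<^sup>2 < 1"
    using r by (simp_all add: power_less_one_iff)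
  then have P0_pos: "0 < 1 - s + m\<^sup>2"
    unfolding P0 by simp
  show "?p \<in> phase_space"
    using r by (intro \<mu>0_in_phase_space) auto
  have "\<forall>\<^sub>F w in nhds m. 0 < 1 - s + w\<^sup>2"
    by (rule order_tendstoD(1)[OF _ P0_pos]) (intro tendsto_intros filterlim_ident)
  moreover have "\<forall>\<^sub>F w in nhds m. 0 < w"
    by (rule order_tendstoD(1)[OF filterlim_ident m])
  ultimately have "\<forall>\<^sub>F w in nhds m. 0 < 1 - s + w\<^sup>2 \<and> 0 < w \<and>
      (w \<noteq> m \<and> (r1 = r2 \<longrightarrow> w < m) \<longrightarrow> 0 < (w - m) * g w)"
    using sign unfolding g_def m_def s_def by eventually_elim auto
  then obtain e where "0 < e" and e: "\<And>w. dist w m < e \<Longrightarrow> 0 < 1 - s + w\<^sup>2 \<and> 0 < w \<and>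
      (w \<noteq> m \<and> (r1 = r2 \<longrightarrow> w < m) \<longrightarrow> 0 < (w - m) * g w)"
    unfolding eventually_nhds_metric by blast
  have h: "h m < h w" if w: "dist w m < e" "w \<noteq> m" "r1 = r2 \<longrightarrow> w < m" for w
  proof (rule strict_min_if_deriv_sign[OF w(2)])
    fix v
    assume "min m w \<le> v" "v \<le> max m w"
    then have "dist v m < e"
      using w(1) by (auto simp: dist_real_def min_def max_def split: if_splits)
    then have v: "0 < 1 - s + v\<^sup>2" "0 < s + 2 * v"
      using e[of v] s by auto
    then show "(h has_real_derivative h' v) (at v)"
      unfolding h_def h'_def g_def
      by (auto intro!: derivative_eq_intros simp: divide_simps)
         (simp add: power2_eq_square algebra_simps)
  next
    fix v
    assume v: "min m w < v" "v < max m w"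
    then have d: "dist v m < e" and "v \<noteq> m" "r1 = r2 \<longrightarrow> v < m"
      using w by (auto simp: dist_real_def min_def max_def split: if_splits)
    then have g: "0 < (v - m) * g v" and pos: "0 < 1 - s + v\<^sup>2" "0 < s + 2 * v"
      using e[of v] s by auto
    have "0 < (w - m) * g v"
      using g v w(2) by (auto simp: zero_less_mult_iff min_def max_def split: if_splits)
    then have "0 < 2 * ((w - m) * g v) / ((1 - s + v\<^sup>2) * (s + 2 * v))"
      using pos by simp
    then show "0 < (w - m) * h' v"
      by (simp add: h'_def mult_ac)
  qed
  define W where "W y = sqrt ((y$3)\<^sup>2 + (y$4)\<^sup>2)" for y :: "real^4"
  have "W ?p = m"
    using m by (simp add: W_def m_def)
  have "(W \<longlongrightarrow> W ?p) (nhds ?p)"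
    unfolding W_def by (intro tendsto_intros filterlim_ident)
  then have "\<forall>\<^sub>F y in nhds ?p. dist (W y) m < e"
    using \<open>0 < e\<close> unfolding \<open>W ?p = m\<close> by (rule tendstoD)
  moreover have "\<forall>\<^sub>F y in nhds ?p. y \<in> phase_space"
    using open_phase_space \<open>?p \<in> phase_space\<close> by (rule eventually_nhds_in_open)
  \<comment> \<open>Sum and product determine \<open>\<mu>1\<close> and \<open>\<mu>2\<close> only
    up to order. Closeness to the equilibrium excludes the configuration with the two radii
    swapped.\<close>
  moreover have "\<forall>\<^sub>F y in nhds ?p. r1 \<noteq> r2 \<longrightarrow> y$1 \<noteq> r2\<^sup>2"
  proof (cases "r1 = r2")
    case False
    then have "r1\<^sup>2 \<noteq> r2\<^sup>2"
      using r by simp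
    then show ?thesis
      by (intro eventually_mono[OF tendsto_imp_eventually_ne[of "\<lambda>y. y$1" "r1\<^sup>2" _ "r2\<^sup>2"]])
        (auto intro!: tendsto_eq_intros filterlim_ident)
  qed simp
  ultimately show "\<forall>\<^sub>F y in nhds ?p. impulse y = impulse ?p \<and> casimir y = casimir ?p
      \<and> energy c y = energy c ?p \<longrightarrow> y = ?p"
  proof eventually_elim
    case (elim y)
    show ?case
    proof (intro impI, elim conjE)
      assume tot: "impulse y = impulse ?p" and cas: "casimir y = casimir ?p"
        and en: "energy c y = energy c ?p"
      define w where "w = W y"
      have "0 < w"
        using e elim by (auto simp: w_def)
      have ww: "w\<^sup>2 = (y$3)\<^sup>2 + (y$4)\<^sup>2"
        by (simp add: w_def W_def)
      have prod: "y$1 * y$2 = w\<^sup>2" and sum: "y$1 + y$2 = s"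
        using tot cas unfolding casimir_\<mu>0 by (auto simp: impulse_def casimir_def ww s_def)
      have y: "y$1 < 1" "y$2 < 1" "0 < s - 2 * y$3"
        using elim sum by (auto simp: phase_space_def)
      have w3: "- y$3 \<le> w"
        using real_sqrt_sum_squares_ge1[of "- y$3" "y$4"] by (auto simp: w_def W_def)
      have "1 - s + w\<^sup>2 = (1 - y$1) * (1 - y$2)"
        using sum prod by (simp add: algebra_simps flip: sum prod)
      then have "energy c y = ln (1 - s + w\<^sup>2) - c * ln (s - 2 * y$3)"
        using y sum by (simp add: energy_def ln_mult)
      moreover have "energy c ?p = h m"
        unfolding energy_def h_def P0
        using sq by (simp add: ln_mult s_def m_def)
      ultimately have eq: "ln (1 - s + w\<^sup>2) - c * ln (s - 2 * y$3) = h m"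
        using en by simp
      moreover have "c * ln (s - 2 * y$3) \<le> c * ln (s + 2 * w)"
        using \<open>0 < c\<close> y w3 by (intro mult_left_mono) auto
      ultimately have "h w \<le> h m"
        by (simp add: h_def)
      \<comment> \<open>Arithmetic and geometric means: \<open>w\<close> is the geometric mean of
        \<open>\<mu>1\<close> and \<open>\<mu>2\<close>, and \<open>m\<close> is their arithmetic
        mean when \<open>r1 = r2\<close>. This is why only \<open>w < r1 * r2\<close> has to be
        examined in that case.\<close>
      moreover have "r1 = r2 \<longrightarrow> w \<le> m"
      proof
        assume "r1 = r2"
        have "(2 * w)\<^sup>2 = (y$1 + y$2)\<^sup>2 - (y$1 - y$2)\<^sup>2"
          using prod by (simp add: power2_eq_square algebra_simps)
        also have "\<dots> \<le> (2 * m)\<^sup>2"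
          unfolding sum by (simp add: \<open>r1 = r2\<close> s_def m_def power2_eq_square)
        finally show "w \<le> m"
          using m power2_le_imp_le[of "2 * w" "2 * m"] by simp
      qed
      ultimately have "w = m"
        using h[of w] elim by (force simp: w_def)
      \<comment> \<open>For \<open>w = m\<close> the lower bound on the energy is attained, which
        forces opposite phases: \<open>\<mu>3 = - m\<close> and hence
        \<open>\<mu>4 = 0\<close>.\<close>
      with eq \<open>0 < c\<close> have "ln (s - 2 * y$3) = ln (s + 2 * m)"
        by (simp add: h_def)
      then have y3: "y$3 = - m"
        using y s m by simp
      with ww \<open>w = m\<close> have y4: "y$4 = 0"
        by simp
      have "(y$1 - r1\<^sup>2) * (y$1 - r2\<^sup>2) = y$1 * y$1 - s * y$1 + m\<^sup>2"
        by (simp add: s_def m_def power_mult_distrib algebra_simps)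
      also have "\<dots> = 0"
        using prod sum \<open>w = m\<close> by (simp add: algebra_simps flip: sum)
      finally have "y$1 = r1\<^sup>2"
        using elim by auto
      with sum y3 y4 show "y = ?p"
        by (simp add: vec_eq_iff forall_4 s_def m_def)
    qed
  qed
qed

subsection \<open>Instability\<close>

text \<open>The Chetaev function is \<open>\<Gamma> (a - a0) \<mu>4\<close> with \<open>a = \<mu>1 - \<mu>2\<close>.  Its derivative along the
  field is \<open>\<Gamma>\<^sup>2 / (P (\<mu>1 + \<mu>2 - 2 \<mu>3))\<close> times the quantity below, where \<open>P = (1 - \<mu>1) (1 - \<mu>2)\<close>.\<close>

definition chetaev_rate :: "real \<Rightarrow> real \<Rightarrow> real^4 \<Rightarrow> real" where
  "chetaev_rate c a0 \<mu> = 4 * c * (\<mu>$4)\<^sup>2 * ((1 - \<mu>$1) * (1 - \<mu>$2))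
     - (\<mu>$1 - \<mu>$2 - a0) * (\<mu>$1 - \<mu>$2) *
       (c * ((1 - \<mu>$1) * (1 - \<mu>$2)) + (\<mu>$1 + \<mu>$2) * \<mu>$3 - 2 * (\<mu>$3)\<^sup>2)"

lemma chetaev_derivative:
  fixes c :: real and \<Gamma> :: int
  assumes "\<mu> \<in> phase_space"
  defines "f \<equiv> vortex_field c \<Gamma> \<mu>"
  shows "of_int \<Gamma> * ((f$1 - f$2) * \<mu>$4 + (\<mu>$1 - \<mu>$2 - a0) * f$4) =
    (of_int \<Gamma>)\<^sup>2 * chetaev_rate c a0 \<mu> / ((1 - \<mu>$1) * (1 - \<mu>$2) * (\<mu>$1 + \<mu>$2 - 2 * \<mu>$3))"
proof -
  define u v s where "u = 1 - \<mu>$1" and "v = 1 - \<mu>$2" and "s = \<mu>$1 + \<mu>$2 - 2 * \<mu>$3"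
  have nz: "u \<noteq> 0" "v \<noteq> 0" "s \<noteq> 0"
    using assms by (auto simp: phase_space_def u_def v_def s_def)
  \<comment> \<open>The identity needs the relation between the three denominators and
    \<open>\<mu>3\<close>; \<open>\<mu>'\<close> supplies it by rewriting the sum
    \<open>\<mu>1 + \<mu>2\<close> that occurs in \<open>chetaev_rate\<close>.\<close>
  have \<mu>: "\<mu>$1 = 1 - u" "\<mu>$2 = 1 - v" and \<mu>': "1 - u + (1 - v) = s + 2 * \<mu>$3"
    by (auto simp: u_def v_def s_def)
  show ?thesis
    using nz unfolding f_def chetaev_rate_def vortex_field_def vector_4
      u_def[symmetric] v_def[symmetric] s_def[symmetric] \<mu> \<mu>'
    by (simp add: divide_simps) (simp add: algebra_simps power2_eq_square)
qed

text \<open>On the surface \<open>\<mu>1 - \<mu>2\<close> and \<open>\<mu>4\<close> are local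
  coordinates at the equilibrium, and \<open>W\<close> is the product of their deviations, as is
  natural at a saddle. The factor \<open>\<Gamma>\<close> in \<open>W\<close> makes its derivative
  carry \<open>\<Gamma>^2\<close>, so one function serves charges of both signs.\<close>

lemma vortex_unstable_if_rate:
  assumes "\<Gamma> \<noteq> 0" and r: "0 < r1" "r1 < 1" "0 < r2" "r2 < 1"
    and rate: "\<forall>\<^sub>F \<mu> in nhds (\<mu>0 r1 r2). impulse \<mu> = r1\<^sup>2 + r2\<^sup>2 \<and> casimir \<mu> = 0 \<longrightarrow>
      0 \<le> chetaev_rate c (r1\<^sup>2 - r2\<^sup>2) \<mu> \<and>
      (\<mu>$1 - \<mu>$2 \<noteq> r1\<^sup>2 - r2\<^sup>2 \<and> \<mu>$4 \<noteq> 0 \<longrightarrow> 0 < chetaev_rate c (r1\<^sup>2 - r2\<^sup>2) \<mu>)"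
  shows "\<not> vortex_stable c \<Gamma> (\<mu>0 r1 r2)"
proof -
  let ?p = "\<mu>0 r1 r2"
  let ?f = "vortex_field c \<Gamma>"
  define s a0 m where "s = r1\<^sup>2 + r2\<^sup>2" and "a0 = r1\<^sup>2 - r2\<^sup>2" and "m = r1 * r2"
  have m: "0 < m" and s: "0 < s"
    using r by (auto simp: m_def s_def intro!: add_pos_pos)
  define S where "S = {\<mu>. impulse \<mu> = s} \<inter> {\<mu>. casimir \<mu> = 0}"
  define W where "W \<mu> = of_int \<Gamma> * ((\<mu>$1 - \<mu>$2 - a0) * \<mu>$4)" for \<mu> :: "real^4"
  define W' where "W' \<mu> h = of_int \<Gamma> * ((h$1 - h$2) * \<mu>$4 + (\<mu>$1 - \<mu>$2 - a0) * h$4)"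
    for \<mu> h :: "real^4"
  have p: "?p \<in> phase_space"
    using r by (intro \<mu>0_in_phase_space) auto
  then have "\<forall>\<^sub>F \<mu> in nhds ?p. \<mu> \<in> phase_space"
    using open_phase_space by (intro eventually_nhds_in_open)
  from eventually_cball_at_right_0[OF this] eventually_cball_at_right_0[OF rate]
    lipschitz_near_vortex_field[OF p, of c \<Gamma>] eventually_at_right_less[of 0]
  have "\<forall>\<^sub>F \<rho> in at_right 0. 0 < \<rho> \<and> (\<exists>L. L-lipschitz_on (cball ?p \<rho>) ?f) \<and>
      (\<forall>\<mu>\<in>cball ?p \<rho>. \<mu> \<in> phase_space \<and> (\<mu> \<in> S \<longrightarrow> 0 \<le> chetaev_rate c a0 \<mu> \<and>
      (\<mu>$1 - \<mu>$2 \<noteq> a0 \<and> \<mu>$4 \<noteq> 0 \<longrightarrow> 0 < chetaev_rate c a0 \<mu>)))"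
    unfolding lipschitz_near_def by eventually_elim (simp add: S_def s_def a0_def)
  then obtain \<rho> L where \<rho>: "0 < \<rho>" and L: "L-lipschitz_on (cball ?p \<rho>) ?f"
    and "\<forall>\<mu>\<in>cball ?p \<rho>. \<mu> \<in> phase_space \<and> (\<mu> \<in> S \<longrightarrow> 0 \<le> chetaev_rate c a0 \<mu> \<and>
      (\<mu>$1 - \<mu>$2 \<noteq> a0 \<and> \<mu>$4 \<noteq> 0 \<longrightarrow> 0 < chetaev_rate c a0 \<mu>))"
    using eventually_happens'[OF trivial_limit_at_right_real] by blast
  then have sub: "\<And>\<mu>. \<mu> \<in> cball ?p \<rho> \<Longrightarrow> \<mu> \<in> phase_space"
    and nonneg: "\<And>\<mu>. \<mu> \<in> S \<inter> cball ?p \<rho> \<Longrightarrow> 0 \<le> chetaev_rate c a0 \<mu>"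
    and pos: "\<And>\<mu>. \<mu> \<in> S \<inter> cball ?p \<rho> \<Longrightarrow> \<mu>$1 - \<mu>$2 \<noteq> a0 \<Longrightarrow> \<mu>$4 \<noteq> 0 \<Longrightarrow> 0 < chetaev_rate c a0 \<mu>"
    by blast+
  have S_rank_one: "S \<subseteq> rank_one_set"
    using s by (auto simp: S_def rank_one_set_def casimir_def impulse_def)
  have W'_eq: "W' \<mu> (?f \<mu>) = (of_int \<Gamma>)\<^sup>2 * chetaev_rate c a0 \<mu> /
      ((1 - \<mu>$1) * (1 - \<mu>$2) * (\<mu>$1 + \<mu>$2 - 2 * \<mu>$3))" if "\<mu> \<in> phase_space" for \<mu>
    unfolding W'_def by (rule chetaev_derivative[OF that])
  have denom: "0 < (1 - \<mu>$1) * (1 - \<mu>$2) * (\<mu>$1 + \<mu>$2 - 2 * \<mu>$3)" if "\<mu> \<in> phase_space" for \<mu>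
    using that by (simp add: phase_space_def)
  show ?thesis
  proof (rule chetaev_instability[OF \<rho>, where S = S and W = W and W' = W'])
    show "closed S"
      unfolding S_def impulse_def casimir_def
      by (intro closed_Int closed_Collect_eq continuous_intros)
    show "S \<inter> cball ?p \<rho> \<subseteq> phase_space \<inter> rank_one_set"
      using sub S_rank_one by blast
    show "x t \<in> S" if "forward_solution ?f phase_space x" "x 0 \<in> S" "0 \<le> t" for x t
      using that(2) conserved_along_solution[OF that(1,3), of impulse "\<lambda>_. impulse"]
        conserved_along_solution[OF that(1,3), of casimir casimir_deriv]
      by (simp add: S_def impulse_has_derivative impulse_vortex_field casimir_has_derivative casimir_vortex_field)
    show "(W has_derivative W' \<mu>) (at \<mu>)" for \<mu>
      unfolding W_def W'_def by (auto intro!: derivative_eq_intros simp: algebra_simps)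
    have "continuous_on (cball ?p \<rho>) ?f"
      by (rule lipschitz_on_continuous_on[OF L])
    then have "continuous_on (S \<inter> cball ?p \<rho>) ?f"
      by (rule continuous_on_subset) auto
    then show "continuous_on (S \<inter> cball ?p \<rho>) (\<lambda>\<mu>. W' \<mu> (?f \<mu>))"
      unfolding W'_def by (intro continuous_intros)
    fix \<mu>
    assume \<mu>: "\<mu> \<in> S \<inter> cball ?p \<rho>"
    then have "\<mu> \<in> phase_space"
      using sub by blast
    then show "0 \<le> W' \<mu> (?f \<mu>)"
      using nonneg[OF \<mu>] denom[of \<mu>] by (simp add: W'_eq)
    assume "0 < W \<mu>"
    then have "0 < chetaev_rate c a0 \<mu>"
      by (intro pos[OF \<mu>]) (auto simp: W_def)
    then show "0 < W' \<mu> (?f \<mu>)"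
      using \<open>\<mu> \<in> phase_space\<close> denom[of \<mu>] \<open>\<Gamma> \<noteq> 0\<close> by (simp add: W'_eq)
  next
    fix \<delta> :: real
    assume "0 < \<delta>"
    define g where "g = (of_int (sgn \<Gamma>) :: real)"
    \<comment> \<open>The point \<open>q \<theta>\<close> of the surface has
      \<open>\<mu>1 - \<mu>2 = a0 + \<theta>\<close> and \<open>\<mu>4 = \<theta>\<close> up to the
      sign of \<open>\<Gamma>\<close>. The vanishing determinant then forces
      \<open>\<mu>3^2 = R \<theta>\<close>, and the negative root is the one near
      \<open>- r1 * r2\<close>. The sign gives
      \<open>W (q \<theta>) = |\<Gamma>| \<theta>^2\<close>.\<close>
    define R where "R \<theta> = m\<^sup>2 - a0 * \<theta> / 2 - \<theta>\<^sup>2 / 4 - \<theta>\<^sup>2" for \<theta> :: real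
    define q where "q \<theta> = (vector [(s + (a0 + \<theta>)) / 2, (s - (a0 + \<theta>)) / 2, - sqrt (R \<theta>), g * \<theta>] :: real^4)" for \<theta>
    have g: "g * g = 1" "0 < of_int \<Gamma> * g"
      using \<open>\<Gamma> \<noteq> 0\<close> by (auto simp: g_def sgn_if)
    have q0: "q 0 = ?p"
      using m by (simp add: vec_eq_iff forall_4 q_def R_def s_def a0_def m_def)
    have "\<forall>i. ((\<lambda>\<theta>. q \<theta> $ i) \<longlongrightarrow> q 0 $ i) (at_right 0)"
      unfolding forall_4 q_def R_def vector_4 by (intro conjI tendsto_intros) auto
    then have "(q \<longlongrightarrow> q 0) (at_right 0)"
      by (intro vec_tendstoI) blast
    then have "\<forall>\<^sub>F \<theta> in at_right 0. dist (q \<theta>) ?p < \<delta>"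
      using \<open>0 < \<delta>\<close> unfolding q0 by (rule tendstoD)
    moreover have "(R \<longlongrightarrow> R 0) (at_right 0)"
      unfolding R_def by (intro tendsto_intros) auto
    then have "\<forall>\<^sub>F \<theta> in at_right 0. 0 < R \<theta>"
      by (rule order_tendstoD) (use m in \<open>simp add: R_def\<close>)
    ultimately have "\<forall>\<^sub>F \<theta> in at_right 0. q \<theta> \<in> S \<and> dist (q \<theta>) ?p < \<delta> \<and> 0 < W (q \<theta>)"
      using eventually_at_right_less[of 0]
    proof eventually_elim
      case (elim \<theta>)
      have "s\<^sup>2 - a0\<^sup>2 = 4 * m\<^sup>2"
        by (simp add: s_def a0_def m_def power2_eq_square algebra_simps)
      then have "casimir (q \<theta>) = 0"
        using elim g by (simp add: casimir_def q_def R_def power_mult_distrib power2_eq_square[of g])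
          (simp add: power2_eq_square field_simps)
      moreover have "impulse (q \<theta>) = s"
        by (simp add: impulse_def q_def field_simps)
      moreover have "W (q \<theta>) = of_int \<Gamma> * g * \<theta>\<^sup>2"
        by (simp add: W_def q_def field_simps power2_eq_square)
      ultimately show ?case
        using elim g by (simp add: S_def)
    qed
    then show "\<exists>\<mu>\<in>S. dist \<mu> ?p < \<delta> \<and> 0 < W \<mu>"
      using eventually_happens'[OF trivial_limit_at_right_real] by blast
  qed
qed

subsection \<open>The two equilibria\<close>

text \<open>With \<open>\<mu>4 = 0\<close> only the last component of the field remains. Over a
  common denominator it is a multiple of \<open>r1^2 - r2^2\<close> times the difference of the two
  sides of condition B, so either alternative makes it vanish.\<close>

lemma vortex_fixed_point_\<mu>0:
  assumes r: "0 \<le> r1" "r1 < 1" "0 \<le> r2" "r2 < 1" "0 < r1 + r2"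
    and eq: "r1 = r2 \<or> c * (1 - r1\<^sup>2) * (1 - r2\<^sup>2) = r1 * r2 * (r1 + r2)\<^sup>2"
  shows "vortex_fixed_point c \<Gamma> (\<mu>0 r1 r2)"
proof -
  have "\<mu>0 r1 r2 \<noteq> 0"
    using r by (auto simp: vec_eq_iff forall_4)
  then have "\<mu>0 r1 r2 \<in> phase_space \<inter> rank_one_set"
    using \<mu>0_in_phase_space[OF r] casimir_\<mu>0[of r1 r2] unfolding casimir_def by (simp add: rank_one_set_def)
  moreover have "c * ((r1\<^sup>2 - r2\<^sup>2) / (r1\<^sup>2 + r2\<^sup>2 - 2 * (- r1 * r2)))
      + (1 / (1 - r1\<^sup>2) - 1 / (1 - r2\<^sup>2)) * (- r1 * r2) = 0"
    using eq
  proof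
    assume eq: "c * (1 - r1\<^sup>2) * (1 - r2\<^sup>2) = r1 * r2 * (r1 + r2)\<^sup>2"
    define u v q where "u = 1 - r1\<^sup>2" and "v = 1 - r2\<^sup>2" and "q = (r1 + r2)\<^sup>2"
    have nz: "u \<noteq> 0" "v \<noteq> 0" "q \<noteq> 0"
      using r power_less_one_iff[of r1 2] power_less_one_iff[of r2 2] by (auto simp: u_def v_def q_def)
    have "r1\<^sup>2 - r2\<^sup>2 = v - u" "r1\<^sup>2 + r2\<^sup>2 - 2 * (- r1 * r2) = q"
      by (auto simp: u_def v_def q_def power2_eq_square algebra_simps)
    moreover have "c * ((v - u) / q) + (1 / u - 1 / v) * (- r1 * r2) = (v - u) * (c * u * v - r1 * r2 * q) / (u * v * q)"
      using nz by (simp add: field_simps)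
    ultimately show ?thesis
      using eq by (simp add: u_def v_def q_def)
  qed simp
  ultimately show ?thesis
    by (simp add: fixed_point_def vortex_field_def vec_eq_iff forall_4)
qed

lemma eventually_nhds_continuous_pos:
  fixes f :: "'a::t2_space \<Rightarrow> real"
  assumes "isCont f p" "0 < f p"
  shows "\<forall>\<^sub>F x in nhds p. 0 < f x"
  using assms order_tendstoD(1)[of f "f p" "nhds p" 0]
  by (simp add: isCont_def tendsto_at_iff_tendsto_nhds)

text \<open>At \<open>w = r^2\<close> the governing polynomial equals
  \<open>4 r^4 - c (1 - r^2)^2 < 0\<close>, and it stays negative nearby. As only
  \<open>w < r^2\<close> occurs, the product with \<open>w - r^2\<close> is positive.\<close>

lemma vortex_A_stable:
  assumes "0 < c" "0 < r" "r < 1" and stable: "4 * r ^ 4 < c * (1 - r\<^sup>2)\<^sup>2"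
  shows "vortex_stable c \<Gamma> (\<mu>0 r r)"
proof (rule vortex_stable_if_sign)
  have "\<forall>\<^sub>F w in nhds (r * r). 0 < c * (1 - (r\<^sup>2 + r\<^sup>2)) - (2 - c) * w\<^sup>2 - (r\<^sup>2 + r\<^sup>2) * w"
  proof (rule eventually_nhds_continuous_pos)
    show "0 < c * (1 - (r\<^sup>2 + r\<^sup>2)) - (2 - c) * (r * r)\<^sup>2 - (r\<^sup>2 + r\<^sup>2) * (r * r)"
      using stable by (simp add: power2_eq_square power4_eq_xxxx algebra_simps)
  qed (intro continuous_intros)
  then show "\<forall>\<^sub>F w in nhds (r * r). w \<noteq> r * r \<and> (r = r \<longrightarrow> w < r * r) \<longrightarrow>
       0 < (w - r * r) * ((2 - c) * w\<^sup>2 + (r\<^sup>2 + r\<^sup>2) * w - c * (1 - (r\<^sup>2 + r\<^sup>2)))"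
    by eventually_elim (auto intro: mult_neg_neg)
qed (use assms in auto)

text \<open>For equal radii \<open>chetaev_rate\<close> is a nonnegative multiple of
  \<open>\<mu>4^2\<close> plus \<open>(\<mu>1 - \<mu>2)^2\<close> times \<open>- ?G\<close>, and
  \<open>?G\<close> takes the value \<open>c (1 - r^2)^2 - 4 r^4 < 0\<close> at the
  equilibrium.\<close>

lemma vortex_A_unstable:
  assumes "0 < c" "\<Gamma> \<noteq> 0" "0 < r" "r < 1" and unstable: "c * (1 - r\<^sup>2)\<^sup>2 < 4 * r ^ 4"
  shows "\<not> vortex_stable c \<Gamma> (\<mu>0 r r)"
proof (rule vortex_unstable_if_rate)
  let ?G = "\<lambda>\<mu>::real^4. c * ((1 - \<mu>$1) * (1 - \<mu>$2)) + (\<mu>$1 + \<mu>$2) * \<mu>$3 - 2 * (\<mu>$3)\<^sup>2"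
  have "\<forall>\<^sub>F \<mu> in nhds (\<mu>0 r r). 0 < - ?G \<mu>"
  proof (rule eventually_nhds_continuous_pos)
    show "0 < - ?G (\<mu>0 r r)"
      using unstable by (simp add: power2_eq_square power4_eq_xxxx algebra_simps)
  qed (intro continuous_intros)
  moreover have "\<forall>\<^sub>F \<mu> in nhds (\<mu>0 r r). \<mu> \<in> phase_space"
    using assms by (intro eventually_nhds_in_open open_phase_space \<mu>0_in_phase_space) auto
  ultimately show "\<forall>\<^sub>F \<mu> in nhds (\<mu>0 r r). impulse \<mu> = r\<^sup>2 + r\<^sup>2 \<and> casimir \<mu> = 0 \<longrightarrow>
      0 \<le> chetaev_rate c (r\<^sup>2 - r\<^sup>2) \<mu> \<and>
      (\<mu>$1 - \<mu>$2 \<noteq> r\<^sup>2 - r\<^sup>2 \<and> \<mu>$4 \<noteq> 0 \<longrightarrow> 0 < chetaev_rate c (r\<^sup>2 - r\<^sup>2) \<mu>)"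
  proof eventually_elim
    case (elim \<mu>)
    have rate: "chetaev_rate c (r\<^sup>2 - r\<^sup>2) \<mu> =
        4 * c * (\<mu>$4)\<^sup>2 * ((1 - \<mu>$1) * (1 - \<mu>$2)) + (\<mu>$1 - \<mu>$2)\<^sup>2 * (- ?G \<mu>)"
      unfolding chetaev_rate_def by (simp add: power2_eq_square algebra_simps)
    have P: "0 < (1 - \<mu>$1) * (1 - \<mu>$2)"
      using elim(2) by (simp add: phase_space_def)
    have "0 \<le> 4 * c * (\<mu>$4)\<^sup>2 * ((1 - \<mu>$1) * (1 - \<mu>$2))"
      using \<open>0 < c\<close> by (intro mult_nonneg_nonneg less_imp_le[OF P]) auto
    moreover have "0 \<le> (\<mu>$1 - \<mu>$2)\<^sup>2 * (- ?G \<mu>)"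
      by (rule mult_nonneg_nonneg[OF zero_le_power2 less_imp_le[OF elim(1)]])
    moreover have "0 < 4 * c * (\<mu>$4)\<^sup>2 * ((1 - \<mu>$1) * (1 - \<mu>$2))" if "\<mu>$4 \<noteq> 0"
      using P \<open>0 < c\<close> that by simp
    ultimately show ?case
      unfolding rate by linarith
  qed
qed (use assms in auto)

text \<open>The first factor is the derivative at \<open>w = r1 * r2\<close> of the polynomial in
  \<open>vortex_stable_if_sign\<close>. It is linear in \<open>c\<close>, and the second factor is
  what allows condition B to eliminate \<open>c\<close>.\<close>

lemma F1_identity:
  assumes "c * (1 - r1\<^sup>2) * (1 - r2\<^sup>2) = r1 * r2 * (r1 + r2)\<^sup>2"
  shows "(2 * (2 - c) * (r1 * r2) + (r1\<^sup>2 + r2\<^sup>2)) * ((1 - r1\<^sup>2) * (1 - r2\<^sup>2)) = - F1 r1 r2"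
proof -
  have "(2 * (2 - c) * (r1 * r2) + (r1\<^sup>2 + r2\<^sup>2)) * ((1 - r1\<^sup>2) * (1 - r2\<^sup>2)) =
      (4 * (r1 * r2) + (r1\<^sup>2 + r2\<^sup>2)) * ((1 - r1\<^sup>2) * (1 - r2\<^sup>2)) -
      2 * (r1 * r2) * (c * (1 - r1\<^sup>2) * (1 - r2\<^sup>2))"
    by (simp add: algebra_simps)
  also have "\<dots> = - F1 r1 r2"
    unfolding assms F1_def by algebra
  finally show ?thesis .
qed

text \<open>Condition B makes \<open>m\<close> a root, so the polynomial is
  \<open>(w - m) * ((2 - c) * (w + m) + s)\<close>. The cofactor is positive at \<open>w = m\<close>
  by the last hypothesis, so the required product is a square times a positive number on both sides
  of \<open>m\<close>.\<close>

lemma vortex_B_stable: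
  assumes "0 < c" and r: "0 < r1" "r1 < 1" "0 < r2" "r2 < 1"
    and eq: "c * (1 - r1\<^sup>2) * (1 - r2\<^sup>2) = r1 * r2 * (r1 + r2)\<^sup>2"
    and D: "0 < 2 * (2 - c) * (r1 * r2) + (r1\<^sup>2 + r2\<^sup>2)"
  shows "vortex_stable c \<Gamma> (\<mu>0 r1 r2)"
proof (rule vortex_stable_if_sign)
  define m s where "m = r1 * r2" and "s = r1\<^sup>2 + r2\<^sup>2"
  have root: "c * (1 - s) = (2 - c) * m\<^sup>2 + s * m"
    using eq unfolding m_def s_def by algebra
  have "\<forall>\<^sub>F w in nhds m. 0 < (2 - c) * (w + m) + s"
    by (rule eventually_nhds_continuous_pos)
      (use D in \<open>auto simp: m_def s_def algebra_simps intro!: continuous_intros\<close>)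
  then show "\<forall>\<^sub>F w in nhds (r1 * r2). w \<noteq> r1 * r2 \<and> (r1 = r2 \<longrightarrow> w < r1 * r2) \<longrightarrow>
       0 < (w - r1 * r2) * ((2 - c) * w\<^sup>2 + (r1\<^sup>2 + r2\<^sup>2) * w - c * (1 - (r1\<^sup>2 + r2\<^sup>2)))"
    unfolding m_def[symmetric] s_def[symmetric]
  proof eventually_elim
    case (elim w)
    have "(w - m) * ((2 - c) * w\<^sup>2 + s * w - c * (1 - s)) = (w - m)\<^sup>2 * ((2 - c) * (w + m) + s)"
      unfolding root by (simp add: power2_eq_square algebra_simps)
    with elim show ?case by simp
  qed
qed (use assms in auto)

text \<open>Here \<open>G\<close> vanishes at the equilibrium, so its sign nearby has to be
  extracted. On the surface \<open>n - m\<close> is expressed by \<open>a - a0\<close> and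
  \<open>\<mu>4\<close>, and multiplication by \<open>4 * (n + m) > 0\<close> turns the rate into
  \<open>(a - a0)^2 * a * (a + a0) * E + 4 * \<mu>4^2 * Z\<close>, a sum of two nonnegative
  terms.\<close>

lemma vortex_B_unstable:
  assumes "0 < c" "\<Gamma> \<noteq> 0" and r: "0 < r1" "r1 < 1" "0 < r2" "r2 < 1"
    and eq: "c * (1 - r1\<^sup>2) * (1 - r2\<^sup>2) = r1 * r2 * (r1 + r2)\<^sup>2"
    and D: "2 * (2 - c) * (r1 * r2) + (r1\<^sup>2 + r2\<^sup>2) < 0"
  shows "\<not> vortex_stable c \<Gamma> (\<mu>0 r1 r2)"
proof (rule vortex_unstable_if_rate)
  let ?p = "\<mu>0 r1 r2"
  define m s a0 where "m = r1 * r2" and "s = r1\<^sup>2 + r2\<^sup>2" and "a0 = r1\<^sup>2 - r2\<^sup>2"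
  have m: "0 < m"
    using r by (simp add: m_def)
  have root: "c * (1 - s) = (2 - c) * m\<^sup>2 + s * m"
    using eq unfolding m_def s_def by algebra
  have leaf: "s\<^sup>2 = a0\<^sup>2 + 4 * m\<^sup>2"
    unfolding m_def s_def a0_def by algebra
  define n where "n \<mu> = - \<mu>$3" for \<mu> :: "real^4"
  define a where "a \<mu> = \<mu>$1 - \<mu>$2" for \<mu> :: "real^4"
  define P where "P \<mu> = (1 - \<mu>$1) * (1 - \<mu>$2)" for \<mu> :: "real^4"
  \<comment> \<open>\<open>E\<close> is the negated difference quotient of the governing polynomial
    between \<open>n\<close> and \<open>m\<close>; at the equilibrium it is the negated derivative,
    which is positive by hypothesis. \<open>Z\<close> collects all that multiplies
    \<open>\<mu>4^2\<close>; its second summand vanishes at the equilibrium because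
    \<open>a = a0\<close>.\<close>
  define E where "E \<mu> = (c - 2) * (n \<mu> + m) - s" for \<mu>
  define Z where "Z \<mu> = 4 * c * P \<mu> * (n \<mu> + m) + (a \<mu> - a0) * a \<mu> * (E \<mu> - c * (n \<mu> + m))" for \<mu>
  note defs = Z_def E_def P_def a_def n_def
  have at_p: "n ?p = m" "a ?p = a0" "P ?p = (1 - r1\<^sup>2) * (1 - r2\<^sup>2)"
    by (simp_all add: n_def a_def P_def m_def a0_def)
  have "\<forall>\<^sub>F \<mu> in nhds ?p. 0 < n \<mu> + m"
    using m by (intro eventually_nhds_continuous_pos) (simp_all add: at_p, simp add: defs)
  moreover have "\<forall>\<^sub>F \<mu> in nhds ?p. 0 < E \<mu>"
  proof (rule eventually_nhds_continuous_pos)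
    show "0 < E ?p"
      using D by (simp add: E_def at_p m_def s_def algebra_simps)
  qed (unfold defs, intro continuous_intros)
  moreover have "\<forall>\<^sub>F \<mu> in nhds ?p. 0 < Z \<mu>"
  proof (rule eventually_nhds_continuous_pos)
    show "0 < Z ?p"
      using m r \<open>0 < c\<close> by (simp add: Z_def at_p power_less_one_iff)
  qed (unfold defs, intro continuous_intros)
  \<comment> \<open>For \<open>a0 \<noteq> 0\<close> the product is close to
    \<open>2 * a0^2\<close>; for \<open>a0 = 0\<close> it is a square, and the term it enters
    becomes quartic in \<open>a\<close>. This is where the degenerate case \<open>r1 = r2\<close> is
    absorbed.\<close>
  moreover have "\<forall>\<^sub>F \<mu> in nhds ?p. 0 \<le> a \<mu> * (a \<mu> + a0)"
  proof (cases "a0 = 0")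
    case False
    then have "\<forall>\<^sub>F \<mu> in nhds ?p. 0 < a \<mu> * (a \<mu> + a0)"
      by (intro eventually_nhds_continuous_pos)
        (simp_all add: at_p, simp add: defs, simp add: zero_less_mult_iff, linarith)
    then show ?thesis
      by eventually_elim simp
  qed simp
  ultimately show "\<forall>\<^sub>F \<mu> in nhds ?p. impulse \<mu> = r1\<^sup>2 + r2\<^sup>2 \<and> casimir \<mu> = 0 \<longrightarrow>
      0 \<le> chetaev_rate c (r1\<^sup>2 - r2\<^sup>2) \<mu> \<and>
      (\<mu>$1 - \<mu>$2 \<noteq> r1\<^sup>2 - r2\<^sup>2 \<and> \<mu>$4 \<noteq> 0 \<longrightarrow> 0 < chetaev_rate c (r1\<^sup>2 - r2\<^sup>2) \<mu>)"
    unfolding s_def[symmetric] a0_def[symmetric]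
  proof eventually_elim
    case (elim \<mu>)
    show ?case
    proof (intro impI)
      assume "impulse \<mu> = s \<and> casimir \<mu> = 0"
      then have s: "\<mu>$1 + \<mu>$2 = s" and cas: "\<mu>$1 * \<mu>$2 = (n \<mu>)\<^sup>2 + (\<mu>$4)\<^sup>2"
        by (simp_all add: impulse_def casimir_def n_def)
      define G where "G = c * P \<mu> - s * n \<mu> - 2 * (n \<mu>)\<^sup>2"
      have P: "P \<mu> = 1 - s + (n \<mu>)\<^sup>2 + (\<mu>$4)\<^sup>2"
        using cas s by (simp add: P_def algebra_simps)
      have G: "G = (n \<mu> - m) * E \<mu> + c * (\<mu>$4)\<^sup>2"
        unfolding G_def P E_def using root by algebra
      have "s\<^sup>2 = (a \<mu>)\<^sup>2 + 4 * ((n \<mu>)\<^sup>2 + (\<mu>$4)\<^sup>2)"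
        unfolding cas[symmetric] s[symmetric] a_def by (simp add: power2_eq_square algebra_simps)
      then have nm: "4 * (n \<mu> - m) * (n \<mu> + m) = - (a \<mu> - a0) * (a \<mu> + a0) - 4 * (\<mu>$4)\<^sup>2"
        using leaf by algebra
      have rate: "chetaev_rate c a0 \<mu> = 4 * c * (\<mu>$4)\<^sup>2 * P \<mu> - (a \<mu> - a0) * a \<mu> * G"
        unfolding chetaev_rate_def s G_def by (simp add: defs)
      have "4 * (n \<mu> + m) * chetaev_rate c a0 \<mu> =
          (a \<mu> - a0)\<^sup>2 * (a \<mu> * (a \<mu> + a0)) * E \<mu> + 4 * (\<mu>$4)\<^sup>2 * Z \<mu>"
        unfolding rate G Z_def using nm by algebra
      moreover have "0 \<le> (a \<mu> - a0)\<^sup>2 * (a \<mu> * (a \<mu> + a0)) * E \<mu>"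
        using elim by simp
      moreover have "0 \<le> 4 * (\<mu>$4)\<^sup>2 * Z \<mu>" "\<mu>$4 \<noteq> 0 \<longrightarrow> 0 < 4 * (\<mu>$4)\<^sup>2 * Z \<mu>"
        using elim by simp_all
      ultimately have "0 \<le> 4 * (n \<mu> + m) * chetaev_rate c a0 \<mu>"
        "\<mu>$4 \<noteq> 0 \<longrightarrow> 0 < 4 * (n \<mu> + m) * chetaev_rate c a0 \<mu>"
        by linarith+
      then show "0 \<le> chetaev_rate c a0 \<mu> \<and>
          (\<mu>$1 - \<mu>$2 \<noteq> a0 \<and> \<mu>$4 \<noteq> 0 \<longrightarrow> 0 < chetaev_rate c a0 \<mu>)"
        using elim by (simp add: zero_le_mult_iff zero_less_mult_iff)
    qed
  qed
qed (use assms in auto)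

theorem proposition3p1:
  fixes c r1 r2 :: real and \<Gamma> :: int
  assumes "c > 0" and "\<Gamma> \<noteq> 0"
    and "0 \<le> r1" "r1 < 1" and "0 \<le> r2" "r2 < 1" and "r1 + r2 > 0"
  shows "(r1 = r2 \<longrightarrow>
            vortex_fixed_point c \<Gamma> (\<mu>0 r1 r2) \<and>
            (c * (1 - r1\<^sup>2)\<^sup>2 > 4 * r1 ^ 4 \<longrightarrow> vortex_stable c \<Gamma> (\<mu>0 r1 r2)) \<and>
            (c * (1 - r1\<^sup>2)\<^sup>2 < 4 * r1 ^ 4 \<longrightarrow> \<not> vortex_stable c \<Gamma> (\<mu>0 r1 r2)))
       \<and> (c * (1 - r1\<^sup>2) * (1 - r2\<^sup>2) = r1 * r2 * (r1 + r2)\<^sup>2 \<longrightarrow>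
            vortex_fixed_point c \<Gamma> (\<mu>0 r1 r2) \<and>
            (F1 r1 r2 < 0 \<longrightarrow> vortex_stable c \<Gamma> (\<mu>0 r1 r2)) \<and>
            (F1 r1 r2 > 0 \<longrightarrow> \<not> vortex_stable c \<Gamma> (\<mu>0 r1 r2)))"
proof (intro conjI impI)
  note r = assms(3-7)
  {
    assume "r1 = r2"
    then have "0 < r1" using r by simp
    show "vortex_fixed_point c \<Gamma> (\<mu>0 r1 r2)"
      using \<open>r1 = r2\<close> by (intro vortex_fixed_point_\<mu>0 r) simp
    show "vortex_stable c \<Gamma> (\<mu>0 r1 r2)" if "4 * r1 ^ 4 < c * (1 - r1\<^sup>2)\<^sup>2"
      using vortex_A_stable[OF assms(1) \<open>0 < r1\<close> r(2) that] \<open>r1 = r2\<close> by simp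
    show "\<not> vortex_stable c \<Gamma> (\<mu>0 r1 r2)" if "c * (1 - r1\<^sup>2)\<^sup>2 < 4 * r1 ^ 4"
      using vortex_A_unstable[OF assms(1,2) \<open>0 < r1\<close> r(2) that] \<open>r1 = r2\<close> by simp
  next
    assume eq: "c * (1 - r1\<^sup>2) * (1 - r2\<^sup>2) = r1 * r2 * (r1 + r2)\<^sup>2"
    show "vortex_fixed_point c \<Gamma> (\<mu>0 r1 r2)"
      using eq by (intro vortex_fixed_point_\<mu>0 r) simp
    have P: "0 < (1 - r1\<^sup>2) * (1 - r2\<^sup>2)"
      using r by (simp add: power_less_one_iff)
    then have "0 < c * (1 - r1\<^sup>2) * (1 - r2\<^sup>2)"
      using assms(1) by (simp add: mult.assoc)
    \<comment> \<open>The left side of condition B is positive, hence so is \<open>r1 * r2\<close>: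
      neither vortex sits at the centre.\<close>
    then have r': "0 < r1" "0 < r2"
      using r unfolding eq by (auto simp: zero_less_mult_iff)
    note F1 = F1_identity[OF eq]
    show "vortex_stable c \<Gamma> (\<mu>0 r1 r2)" if "F1 r1 r2 < 0"
      using that F1 P by (intro vortex_B_stable assms r' eq) (metis neg_0_less_iff_less zero_less_mult_pos2)
    show "\<not> vortex_stable c \<Gamma> (\<mu>0 r1 r2)" if "0 < F1 r1 r2"
      using that F1 P by (intro vortex_B_unstable assms r' eq) (smt (verit) mult_nonneg_nonneg)
  }
qed

end
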